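(* There exists a non-empty open set $V$ in $(\mathrm{Poly}_{\deg\ge2})^3$ such that for any $(h_1,h_2,h_3)\in V$, the semigroup $G=\langle h_1,h_2,h_3\rangle$ satisfies $G\in\mathcal G_{dis}$, $J(h_1)\cup J(h_2)\subset J_{\min}(G)$, $J_{\max}(G)=J(h_3)$, $h_j^{-1}(J(h_3))\cap J_{\min}(G)\ne\emptyset$ for each $j=1,2$, and $\sharp(\hat{\mathcal J}_G)=\aleph_0$.
   Context: $\hat{\mathbb C}$ is the Riemann sphere. $\mathrm{Poly}_{\deg\ge2}$ is the set of polynomial maps $\hat{\mathbb C}\to\hat{\mathbb C}$ of degree at least two, with the topology of uniform convergence on $\hat{\mathbb C}$ with respect to the spherical distance. A polynomial semigroup is a semigroup (under composition) generated by a family of non-constant polynomial maps; $\langle h_1,h_2,h_3\rangle$ is the semigroup generated by $h_1,h_2,h_3$. The Fatou set $F(G)$ is the set of $z\in\hat{\mathbb C}$ having a neighborhood on which $G$ is a normal family; the Julia set is $J(G)=\hat{\mathbb C}\setminus F(G)$; $J(g)$ is the Julia set of the semigroup generated by $g$. $P(G)=\overline{\bigcup_{g\in G}\{\text{critical values of } g:\hat{\mathbb C}\to\hat{\mathbb C}\}}$ and $P^{*}(G)=P(G)\setminus\{\infty\}$. $\mathcal G$ is the set of polynomial semigroups $G$ all of whose elements have degree at least two and for which $P^{*}(G)$ is bounded in $\mathbb C$; $\mathcal G_{dis}=\{G\in\mathcal G:J(G)\text{ disconnected}\}$. $\hat{\mathcal J}_G$ is the set of all connected components of $J(G)$ and $\mathcal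 J_G$ the set of those contained in $\mathbb C$. For connected sets $K_1,K_2\subset\mathbb C$, $K_1\le K_2$ means $K_1=K_2$ or $K_1$ is contained in a bounded component of $\mathbb C\setminus K_2$. For $G\in\mathcal G_{dis}$, $J_{\min}(G)$ and $J_{\max}(G)$ denote the unique elements of $\mathcal J_G$ with $J_{\min}(G)\le J\le J_{\max}(G)$ for all $J\in\mathcal J_G$ (they exist). *)

theory Defs
  imports "HOL-Analysis.Analysis" "HOL-Library.Equipollence"
    "HOL-Computational_Algebra.Polynomial"
begin

section \<open>The Riemann sphere\<close>

datatype rsphere = Fin complex | Infty

text \<open>Inverse stereographic projection onto the unit sphere of \<open>complex \<times> real\<close>.\<close>

fun stereo :: "rsphere \<Rightarrow> complex \<times> real" where
  "stereo (Fin z) = ((2 / (1 + (cmod z)\<^sup>2)) *\<^sub>R z, ((cmod z)\<^sup>2 - 1) / ((cmod z)\<^sup>2 + 1))"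
| "stereo Infty = (0, 1)"

lemma norm_stereo [simp]: "norm (stereo x) = 1"
proof (cases x)
  case (Fin z)
  define r where "r = (cmod z)\<^sup>2"
  have r: "r \<ge> 0" by (simp add: r_def)
  have "(2 / (1 + r) * cmod z)\<^sup>2 + ((r - 1) / (r + 1))\<^sup>2 = 1"
  proof -
    have "(2 / (1 + r) * cmod z)\<^sup>2 = 4 * r / (1 + r)\<^sup>2"
      by (simp add: power_mult_distrib power_divide r_def)
    also have "\<dots> + ((r - 1) / (r + 1))\<^sup>2 = (4 * r + (r - 1)\<^sup>2) / (1 + r)\<^sup>2"
      by (simp add: power_divide add_divide_distrib add.commute)
    also have "4 * r + (r - 1)\<^sup>2 = (1 + r)\<^sup>2"
      by (simp add: power2_eq_square algebra_simps)
    also have "(1 + r)\<^sup>2 / (1 + r)\<^sup>2 = 1" using r by simp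
    finally show ?thesis .
  qed
  then show ?thesis
    using r unfolding Fin by (simp add: norm_Pair r_def [symmetric] power_divide)
qed (simp add: norm_Pair)

lemma stereo_inject: "stereo x = stereo y \<longleftrightarrow> x = y"
proof -
  have pos: "1 + (cmod z)\<^sup>2 > 0" for z
    by (simp add: add_pos_nonneg)
  have snd_eq: "snd (stereo (Fin z)) = 1 - 2 / (1 + (cmod z)\<^sup>2)" for z
    using pos[of z] by (simp add: field_simps)
  have "stereo (Fin z) \<noteq> stereo Infty" for z
  proof
    assume "stereo (Fin z) = stereo Infty"
    then have "snd (stereo (Fin z)) = 1" by simp
    then show False unfolding snd_eq using pos[of z] by simp
  qed
  moreover have "z = w" if "stereo (Fin z) = stereo (Fin w)" for z w
  proof -
    have "2 / (1 + (cmod z)\<^sup>2) = 2 / (1 + (cmod w)\<^sup>2)"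
      using arg_cong[OF that, of snd] unfolding snd_eq by linarith
    moreover have "(2 / (1 + (cmod z)\<^sup>2)) *\<^sub>R z = (2 / (1 + (cmod w)\<^sup>2)) *\<^sub>R w"
      using that unfolding stereo.simps by (rule Pair_inject)
    ultimately have "(2 / (1 + (cmod w)\<^sup>2)) *\<^sub>R z = (2 / (1 + (cmod w)\<^sup>2)) *\<^sub>R w"
      by (simp only:)
    then show ?thesis using pos[of w]
      by (subst (asm) scaleR_cancel_left) simp
  qed
  ultimately show ?thesis
    by (cases x; cases y) metis+
qed

lemma angle_triangle:
  fixes x y z :: "'a::real_inner"
  assumes [simp]: "norm x = 1" "norm y = 1" "norm z = 1"
  shows "arccos (x \<bullet> z) \<le> arccos (x \<bullet> y) + arccos (y \<bullet> z)"
proof -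
  have bd: "\<bar>a \<bullet> b\<bar> \<le> 1" if "norm a = 1" "norm b = 1" for a b :: 'a
    using Cauchy_Schwarz_ineq2[of a b] that by simp
  define a where "a = x \<bullet> y"
  define b where "b = y \<bullet> z"
  have ab: "-1 \<le> a" "a \<le> 1" "-1 \<le> b" "b \<le> 1" "-1 \<le> x \<bullet> z" "x \<bullet> z \<le> 1"
    using bd[of x y] bd[of y z] bd[of x z] by (auto simp: a_def b_def abs_le_iff)
  have unit: "x \<bullet> x = 1" "y \<bullet> y = 1" "z \<bullet> z = 1"
    by (simp_all add: dot_square_norm)
  define u where "u = x - a *\<^sub>R y"
  define v where "v = z - b *\<^sub>R y"
  have nu: "norm u = sqrt (1 - a\<^sup>2)"
    unfolding norm_eq_sqrt_inner u_def
    by (simp add: inner_diff_left inner_diff_right unit a_def inner_commute power2_eq_square)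
  have nv: "norm v = sqrt (1 - b\<^sup>2)"
    unfolding norm_eq_sqrt_inner v_def
    by (simp add: inner_diff_left inner_diff_right unit b_def inner_commute power2_eq_square)
  have uv: "u \<bullet> v = x \<bullet> z - a * b"
    by (simp add: u_def v_def inner_diff_left inner_diff_right unit a_def b_def inner_commute)
  have "- (norm u * norm v) \<le> u \<bullet> v"
    using Cauchy_Schwarz_ineq2[of u v] by linarith
  then have main: "a * b - sqrt (1 - a\<^sup>2) * sqrt (1 - b\<^sup>2) \<le> x \<bullet> z"
    by (simp add: nu nv uv)
  have "cos (arccos a + arccos b) = a * b - sqrt (1 - a\<^sup>2) * sqrt (1 - b\<^sup>2)"
    using ab by (simp add: cos_add sin_arccos_abs abs_le_iff)
  with main have le: "cos (arccos a + arccos b) \<le> cos (arccos (x \<bullet> z))"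
    using ab by simp
  show ?thesis
  proof (cases "arccos a + arccos b \<le> pi")
    case True
    then show ?thesis
      using le ab cos_mono_le_eq[of "arccos a + arccos b" "arccos (x \<bullet> z)"]
      by (simp add: arccos_lbound arccos_ubound a_def b_def)
  next
    case False
    then show ?thesis
      using arccos_ubound[of "x \<bullet> z"] ab by (simp add: a_def b_def)
  qed
qed

text \<open>The spherical distance is the length of a shortest great-circle arc.\<close>

instantiation rsphere :: metric_space
begin

definition dist_rsphere_def: "dist x y = arccos (stereo x \<bullet> stereo y)"

definition uniformity_rsphere_def:
  "(uniformity :: (rsphere \<times> rsphere) filter) = (INF e\<in>{0 <..}. principal {(x, y). dist x y < e})"

definition open_rsphere_def:
  "open (U :: rsphere set) \<longleftrightarrow> (\<forall>x\<in>U. eventually (\<lambda>(x', y). x' = x \<longrightarrow> y \<in> U) uniformity)"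

instance
proof
  fix x y z :: rsphere
  have bd: "\<bar>stereo a \<bullet> stereo b\<bar> \<le> 1" for a b
    using Cauchy_Schwarz_ineq2[of "stereo a" "stereo b"] by simp
  show "dist x y = 0 \<longleftrightarrow> x = y"
  proof
    assume "dist x y = 0"
    then have "stereo x \<bullet> stereo y = 1"
      using bd[of x y] unfolding dist_rsphere_def by (metis cos_arccos_abs cos_zero)
    then have "(norm (stereo x - stereo y))\<^sup>2 = 0"
      using dot_norm_neg[of "stereo x" "stereo y"] by simp
    then show "x = y" by (simp add: stereo_inject)
  next
    assume "x = y"
    then show "dist x y = 0"
      by (simp add: dist_rsphere_def dot_square_norm)
  qed
  show "dist x y \<le> dist x z + dist y z"
    using angle_triangle[of "stereo x" "stereo z" "stereo y"]
    by (simp add: dist_rsphere_def inner_commute)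
qed (simp_all add: uniformity_rsphere_def open_rsphere_def)

end

lemma dist_rsphere_le_pi: "dist (x :: rsphere) y \<le> pi"
  using Cauchy_Schwarz_ineq2[of "stereo x" "stereo y"]
  by (simp add: dist_rsphere_def arccos_ubound abs_le_iff)

section \<open>Polynomial maps\<close>

fun poly_map :: "complex poly \<Rightarrow> rsphere \<Rightarrow> rsphere" where
  "poly_map p (Fin z) = Fin (poly p z)"
| "poly_map p Infty = Infty"

definition Poly_nonconst :: "(rsphere \<Rightarrow> rsphere) set" where
  "Poly_nonconst = {poly_map p | p. degree p \<ge> 1}"

definition Poly_deg_ge2 :: "(rsphere \<Rightarrow> rsphere) set" where
  "Poly_deg_ge2 = {poly_map p | p. degree p \<ge> 2}"

definition unif_dist :: "(rsphere \<Rightarrow> rsphere) \<Rightarrow> (rsphere \<Rightarrow> rsphere) \<Rightarrow> real" where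
  "unif_dist f g = (SUP z. dist (f z) (g z))"

definition Poly_top :: "(rsphere \<Rightarrow> rsphere) topology" where
  "Poly_top = Metric_space.mtopology Poly_deg_ge2 unif_dist"

lemma bdd_above_unif_dist: "bdd_above (range (\<lambda>z. dist (f z :: rsphere) (g z)))"
  by (rule bdd_aboveI[of _ pi]) (auto simp: dist_rsphere_le_pi)

lemma dist_le_unif_dist: "dist (f z) (g z) \<le> unif_dist f g"
  unfolding unif_dist_def by (intro cSUP_upper bdd_above_unif_dist UNIV_I)

lemma Metric_space_unif_dist: "Metric_space A unif_dist"
proof
  fix f g h :: "rsphere \<Rightarrow> rsphere"
  show "0 \<le> unif_dist f g"
    by (rule order_trans[OF zero_le_dist dist_le_unif_dist[of f Infty g]])
  show "unif_dist f g = unif_dist g f"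
    by (simp add: unif_dist_def dist_commute)
  show "unif_dist f g = 0 \<longleftrightarrow> f = g"
  proof
    assume "unif_dist f g = 0"
    then have "dist (f z) (g z) \<le> 0" for z
      using dist_le_unif_dist[of f z g] by simp
    then show "f = g" by auto
  qed (simp add: unif_dist_def)
  show "unif_dist f h \<le> unif_dist f g + unif_dist g h"
    unfolding unif_dist_def[of f h]
  proof (rule cSUP_least)
    fix z
    show "dist (f z) (h z) \<le> unif_dist f g + unif_dist g h"
      using dist_triangle[of "f z" "h z" "g z"] dist_le_unif_dist[of f z g]
        dist_le_unif_dist[of g z h] by linarith
  qed simp
qed

section \<open>Polynomial semigroups, Fatou and Julia sets\<close>

inductive_set sgen :: "(rsphere \<Rightarrow> rsphere) set \<Rightarrow> (rsphere \<Rightarrow> rsphere) set"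
  for H :: "(rsphere \<Rightarrow> rsphere) set" where
  base: "h \<in> H \<Longrightarrow> h \<in> sgen H"
| comp: "f \<in> sgen H \<Longrightarrow> g \<in> sgen H \<Longrightarrow> f \<circ> g \<in> sgen H"

definition polynomial_semigroup :: "(rsphere \<Rightarrow> rsphere) set \<Rightarrow> bool" where
  "polynomial_semigroup G \<longleftrightarrow> (\<exists>H. H \<noteq> {} \<and> H \<subseteq> Poly_nonconst \<and> G = sgen H)"

text \<open>Locally uniform convergence with respect to the spherical distance; as the limit takes values
  in the sphere, divergence to infinity needs no separate clause.\<close>

definition normal_family_on :: "(rsphere \<Rightarrow> rsphere) set \<Rightarrow> rsphere set \<Rightarrow> bool" where
  "normal_family_on G U \<longleftrightarrow>
     (\<forall>f :: nat \<Rightarrow> rsphere \<Rightarrow> rsphere. range f \<subseteq> G \<longrightarrow>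
        (\<exists>r l. strict_mono r \<and>
           (\<forall>K. compact K \<and> K \<subseteq> U \<longrightarrow> uniform_limit K (\<lambda>n. f (r n)) l sequentially)))"

definition Fatou :: "(rsphere \<Rightarrow> rsphere) set \<Rightarrow> rsphere set" where
  "Fatou G = {z. \<exists>U. open U \<and> z \<in> U \<and> normal_family_on G U}"

definition Julia :: "(rsphere \<Rightarrow> rsphere) set \<Rightarrow> rsphere set" where
  "Julia G = UNIV - Fatou G"

definition Julia1 :: "(rsphere \<Rightarrow> rsphere) \<Rightarrow> rsphere set" where
  "Julia1 g = Julia (sgen {g})"

section \<open>Critical values and the postcritical set\<close>

text \<open>The coordinate used at a finite point is the affine one, and at \<open>Infty\<close> it is \<open>1/z\<close>. Each
  coordinate omits one point of the sphere, where \<open>coord\<close> has the dummy value \<open>0\<close>; this is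
  harmless, as only the germ of \<open>coord c\<close> at \<open>c\<close> matters.\<close>

definition coord :: "rsphere \<Rightarrow> rsphere \<Rightarrow> complex" where
  "coord c x = (case x of Fin z \<Rightarrow> (if c = Infty then inverse z else z) | Infty \<Rightarrow> 0)"

definition coord_inv :: "rsphere \<Rightarrow> complex \<Rightarrow> rsphere" where
  "coord_inv c w = (if c = Infty then if w = 0 then Infty else Fin (inverse w) else Fin w)"

definition critical_point :: "(rsphere \<Rightarrow> rsphere) \<Rightarrow> rsphere \<Rightarrow> bool" where
  "critical_point g c \<longleftrightarrow>
     ((\<lambda>w. coord (g c) (g (coord_inv c w))) has_field_derivative 0) (at (coord c c))"

definition critical_values :: "(rsphere \<Rightarrow> rsphere) \<Rightarrow> rsphere set" where
  "critical_values g = g ` {c. critical_point g c}"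

definition postcritical :: "(rsphere \<Rightarrow> rsphere) set \<Rightarrow> rsphere set" where
  "postcritical G = closure (\<Union>g\<in>G. critical_values g)"

definition postcritical_fin :: "(rsphere \<Rightarrow> rsphere) set \<Rightarrow> complex set" where
  "postcritical_fin G = Fin -` (postcritical G - {Infty})"

definition \<G> :: "(rsphere \<Rightarrow> rsphere) set set" where
  "\<G> = {G. polynomial_semigroup G \<and> G \<subseteq> Poly_deg_ge2 \<and> bounded (postcritical_fin G)}"

definition \<G>_dis :: "(rsphere \<Rightarrow> rsphere) set set" where
  "\<G>_dis = {G \<in> \<G>. \<not> connected (Julia G)}"

section \<open>Components of the Julia set\<close>

definition Jhat :: "(rsphere \<Rightarrow> rsphere) set \<Rightarrow> rsphere set set" where
  "Jhat G = components (Julia G)"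

definition Jfin :: "(rsphere \<Rightarrow> rsphere) set \<Rightarrow> rsphere set set" where
  "Jfin G = {K \<in> Jhat G. K \<subseteq> range Fin}"

definition surr_le :: "complex set \<Rightarrow> complex set \<Rightarrow> bool" where
  "surr_le K1 K2 \<longleftrightarrow> K1 = K2 \<or> (\<exists>B \<in> components (UNIV - K2). bounded B \<and> K1 \<subseteq> B)"

definition Jmin :: "(rsphere \<Rightarrow> rsphere) set \<Rightarrow> rsphere set" where
  "Jmin G = (THE K. K \<in> Jfin G \<and> (\<forall>J \<in> Jfin G. surr_le (Fin -` K) (Fin -` J)))"

definition Jmax :: "(rsphere \<Rightarrow> rsphere) set \<Rightarrow> rsphere set" where
  "Jmax G = (THE K. K \<in> Jfin G \<and> (\<forall>J \<in> Jfin G. surr_le (Fin -` J) (Fin -` K)))"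

end

theory Submission
  imports Defs "HOL-Complex_Analysis.Great_Picard"
    "HOL-Computational_Algebra.Fundamental_Theorem_Algebra"
begin

text \<open>
  The model triple is \<open>z^16\<close>, \<open>(z - 1/4)^16\<close>, \<open>z^16 / 2^15\<close>. For every triple close to it, each map
  sends \<open>{|z| \<le> 1/2}\<close> and \<open>{|z| \<ge> 4}\<close> into their interiors, has all its zeros in the inner disc and is
  expanding wherever its value lies in the annulus \<open>D\<close> between them. Hence the Julia set is the limit
  set of the system, that is, the intersection of the unions of preimages of \<open>D\<close> under words of
  length \<open>n\<close>.

  Call a continuum in \<open>D\<close> that separates the inner disc from infinity a ring. Preimages of rings
  are rings, by unicoherence of the plane. Since \<open>h1\<close> and \<open>h2\<close> have shifted centres and high degree,
  any \<open>h1\<close>-preimage of a ring crosses any \<open>h2\<close>-preimage of a ring, so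
  \<open>A = h1\<inverse>(J(G)) \<union> h2\<inverse>(J(G))\<close> is a decreasing intersection of continua and therefore connected.
  As \<open>h3\<inverse>(D)\<close> lies outside a disc that contains \<open>A\<close>, the components of \<open>J(G)\<close> are the nested
  rings \<open>h3\<^sup>-\<^sup>n(A)\<close> together with their limit \<open>J(h3)\<close>.
\<close>

section \<open>Topology of the sphere\<close>

text \<open>Degree 16 makes the preimages of \<open>annulus (1/2) 4\<close> under \<open>h1\<close>
  and \<open>h2\<close> thin: they lie between the radii 9/10 and 11/10 about 0 and 1/4. Rings in
  them cross because the shift 1/4 exceeds the width 1/5. Both preimages lie in the disc of radius
  27/20 = 11/10 + 1/4, which \<open>h3\<close> sends into the inner disc; the factor 1 / 2^15 puts
  the Julia set of the third model on the circle of radius 2, outside that disc. The component of a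
  point is thus decided by how often \<open>h3\<close> is applied before \<open>h1\<close> or
  \<open>h2\<close> first occurs; what follows is fused into one continuum. This yields countably
  many components and no Cantor family. The obstacle is that J(G) is disconnected, so
  \<open>A\<close> is not the preimage of a connected set. The finite levels are therefore kept as
  unions of rings, and the crossing of single rings does the gluing. The condition on zeros serves
  twice: it puts the finite critical values of the whole semigroup into the inner disc, and it
  confines one fibre to a connected set, from which connectedness of preimages follows.\<close>

lemma continuous_on_stereo: "continuous_on S stereo"
proof -
  \<comment> \<open>The chord belonging to an arc of length d has length 2 sin(d/2), which is at
    most d.\<close>
  have "norm (stereo x - stereo y) \<le> dist x y" for x y
  proof -
    define d where "d = dist x y"
    have bd: "\<bar>stereo x \<bullet> stereo y\<bar> \<le> 1"
      using Cauchy_Schwarz_ineq2[of "stereo x" "stereo y"] by simp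
    have d: "0 \<le> d" "cos d = stereo x \<bullet> stereo y"
      using bd by (auto simp: d_def) (simp add: dist_rsphere_def)
    have "(norm (stereo x - stereo y))\<^sup>2 = 2 - 2 * cos d"
      using dot_norm_neg[of "stereo x" "stereo y"] by (simp add: d)
    also have "\<dots> = (2 * sin (d/2))\<^sup>2"
      using cos_double_sin[of "d/2"] by (simp add: power_mult_distrib)
    also have "\<dots> \<le> d\<^sup>2"
      using abs_sin_le_one[of "d/2"] abs_sin_x_le_abs_x[of "d/2"]
      by (intro abs_le_square_iff[THEN iffD1]) (auto simp: abs_mult)
    finally show ?thesis using d(1) unfolding d_def by (rule power2_le_imp_le)
  qed
  then show ?thesis
    unfolding continuous_on_iff by (metis dist_norm order_le_less_trans)
qed

text \<open>The spherical metric induces the topology of the unit sphere, so questions of continuity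
  on \<open>rsphere\<close> become questions in \<open>complex \<times> real\<close>. The converse
  direction is continuity of \<open>arccos\<close> at inner product 1.\<close>

lemma tendsto_rsphere_iff:
  "(f \<longlongrightarrow> a) F \<longleftrightarrow> ((\<lambda>x. stereo (f x)) \<longlongrightarrow> stereo a) F"
proof
  assume "(f \<longlongrightarrow> a) F"
  then show "((\<lambda>x. stereo (f x)) \<longlongrightarrow> stereo a) F"
    by (rule continuous_on_tendsto_compose[OF continuous_on_stereo[of UNIV]]) auto
next
  assume "((\<lambda>x. stereo (f x)) \<longlongrightarrow> stereo a) F"
  then have "((\<lambda>x. stereo (f x) \<bullet> stereo a) \<longlongrightarrow> stereo a \<bullet> stereo a) F"
    by (intro tendsto_intros)
  then have "((\<lambda>x. arccos (stereo (f x) \<bullet> stereo a)) \<longlongrightarrow> arccos (stereo a \<bullet> stereo a)) F"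
  proof (rule continuous_on_tendsto_compose[OF continuous_on_arccos'])
    have "\<bar>stereo x \<bullet> stereo y\<bar> \<le> 1" for x y
      using Cauchy_Schwarz_ineq2[of "stereo x" "stereo y"] by simp
    then show "stereo a \<bullet> stereo a \<in> {-1..1}" "\<forall>\<^sub>F x in F. stereo (f x) \<bullet> stereo a \<in> {-1..1}"
      by (auto simp: abs_le_iff)
  qed
  moreover have "arccos (stereo a \<bullet> stereo a) = 0"
    by (simp add: dot_square_norm)
  ultimately have "((\<lambda>x. dist (f x) a) \<longlongrightarrow> 0) F"
    unfolding dist_rsphere_def by (simp only:)
  then show "(f \<longlongrightarrow> a) F" by (subst tendsto_dist_iff)
qed

lemma continuous_on_Fin [continuous_intros]:
  assumes "continuous_on S f"
  shows "continuous_on S (\<lambda>x. Fin (f x))"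
proof -
  have "1 + (cmod z)\<^sup>2 \<noteq> 0" for z
    using zero_le_power2[of "cmod z"] by linarith
  then have "continuous_on S (\<lambda>x. stereo (Fin (f x)))"
    unfolding stereo.simps using assms by (intro continuous_intros) (auto simp: add.commute)
  then show ?thesis
    unfolding continuous_on_def tendsto_rsphere_iff[where f="\<lambda>x. Fin (f x)"] .
qed

definition the_fin :: "rsphere \<Rightarrow> complex" where
  "the_fin x = (case x of Fin z \<Rightarrow> z | Infty \<Rightarrow> 0)"

lemma the_fin_Fin [simp]: "the_fin (Fin z) = z"
  by (simp add: the_fin_def)

lemma range_Fin: "range Fin = - {Infty}"
proof (rule set_eqI)
  show "x \<in> range Fin \<longleftrightarrow> x \<in> - {Infty}" for x
    by (cases x) auto
qed

lemma snd_stereo_Fin: "snd (stereo (Fin z)) = 1 - 2 / (1 + (cmod z)\<^sup>2)"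
proof -
  have "1 + (cmod z)\<^sup>2 > 0" by (simp add: add_pos_nonneg)
  then show ?thesis by (simp add: field_simps)
qed

text \<open>Stereographic projection divides the horizontal part by one minus the height, and this
  denominator vanishes only at the north pole.\<close>

lemma continuous_on_the_fin: "continuous_on (range Fin) the_fin"
proof -
  have pos: "1 + (cmod z)\<^sup>2 > 0" for z
    by (simp add: add_pos_nonneg)
  have eq: "the_fin x = fst (stereo x) /\<^sub>R (1 - snd (stereo x))" if "x \<in> range Fin" for x :: rsphere
  proof -
    obtain z where x: "x = Fin z" using \<open>x \<in> range Fin\<close> by auto
    define a where "a = 2 / (1 + (cmod z)\<^sup>2)"
    have "a \<noteq> 0" using pos[of z] by (simp add: a_def)
    moreover have "1 - snd (stereo x) = a" unfolding x snd_stereo_Fin a_def by simp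
    moreover have "fst (stereo x) = a *\<^sub>R z" by (simp add: x a_def)
    ultimately have "fst (stereo x) /\<^sub>R (1 - snd (stereo x)) = z" by simp
    then show ?thesis by (simp add: x del: stereo.simps)
  qed
  have ne: "1 - snd (stereo x) \<noteq> 0" if x: "x \<in> range Fin" for x
  proof -
    obtain z where "x = Fin z" using x by auto
    then show ?thesis using pos[of z] by (simp add: snd_stereo_Fin del: stereo.simps)
  qed
  have "continuous_on (range Fin) (\<lambda>x. fst (stereo x) /\<^sub>R (1 - snd (stereo x)))"
    using ne by (intro continuous_intros continuous_on_stereo) auto
  then show ?thesis by (subst continuous_on_cong[OF refl eq])
qed

lemma open_Fin_image:
  assumes "open U"
  shows "open (Fin ` U)"
proof -
  have "open (range Fin)" unfolding range_Fin by (simp add: open_Compl)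
  then have "open (the_fin -` U \<inter> range Fin)"
    using continuous_on_the_fin assms by (simp add: continuous_on_open_vimage)
  moreover have "the_fin -` U \<inter> range Fin = Fin ` U" by auto
  ultimately show ?thesis by simp
qed

lemma continuous_on_the_fin_subset: "S \<subseteq> range Fin \<Longrightarrow> continuous_on S the_fin"
  using continuous_on_the_fin continuous_on_subset by blast

lemma Fin_vimage_eq: "S \<subseteq> range Fin \<Longrightarrow> Fin -` S = the_fin ` S"
  by force

lemma compact_Fin_vimage: "compact S \<Longrightarrow> S \<subseteq> range Fin \<Longrightarrow> compact (Fin -` S)"
  by (simp add: Fin_vimage_eq compact_continuous_image continuous_on_the_fin_subset)

lemma connected_Fin_vimage: "connected S \<Longrightarrow> S \<subseteq> range Fin \<Longrightarrow> connected (Fin -` S)"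
  by (simp add: Fin_vimage_eq connected_continuous_image continuous_on_the_fin_subset)

lemma compact_Fin_image: "compact S \<Longrightarrow> compact (Fin ` S)"
  by (intro compact_continuous_image continuous_intros)

lemma connected_Fin_image: "connected S \<Longrightarrow> connected (Fin ` S)"
  by (intro connected_continuous_image continuous_intros)

lemma surj_stereo_sphere: assumes "norm u = 1" shows "\<exists>x. stereo x = u"
  proof (cases u)
    case (Pair w t)
    have eq: "(cmod w)\<^sup>2 + t\<^sup>2 = 1" using assms by (simp add: Pair norm_Pair)
    show ?thesis
    proof (cases "t = 1")
      case True
      then have "w = 0" using eq by simp
      then have "stereo Infty = u" using True Pair by simp
      then show ?thesis by blast
    next
      case False
      have "t\<^sup>2 \<le> 1" using eq zero_le_power2[of "cmod w"] by linarith
      then have "t \<le> 1" using power2_le_imp_le[of t 1] by simp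
      then have t: "1 - t > 0" using False by simp
      define z where "z = w /\<^sub>R (1 - t)"
      have "(cmod z)\<^sup>2 = (cmod w)\<^sup>2 / (1 - t)\<^sup>2"
        using t by (simp add: z_def power_mult_distrib field_simps)
      also have "\<dots> = ((1 - t) * (1 + t)) / ((1 - t) * (1 - t))"
        using eq by (simp add: power2_eq_square algebra_simps)
      also have "\<dots> = (1 + t) / (1 - t)"
        using t by simp
      finally have nz: "(cmod z)\<^sup>2 = (1 + t) / (1 - t)" .
      have a: "1 + (cmod z)\<^sup>2 = 2 / (1 - t)" using t unfolding nz by (simp add: field_simps)
      then have "snd (stereo (Fin z)) = t"
        using t by (simp add: add.commute nz) (simp add: field_simps)
      moreover have "2 / (1 + (cmod z)\<^sup>2) = 1 - t" unfolding a by simp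
      then have "fst (stereo (Fin z)) = w"
        using t by (simp add: z_def)
      ultimately have "stereo (Fin z) = u"
        unfolding Pair by (metis prod.collapse)
      then show ?thesis by blast
    qed
  qed

lemma compact_rsphere: "compact (UNIV :: rsphere set)"
proof -
  define g where "g = (\<lambda>u. SOME x. stereo x = u)"
  have sg: "stereo (g u) = u" if "norm u = 1" for u
    unfolding g_def using someI_ex[OF surj_stereo_sphere[OF that]] .
  \<comment> \<open>By \<open>tendsto_rsphere_iff\<close> it suffices to compose \<open>g\<close>
    with \<open>stereo\<close>, and the composite is the identity of the unit sphere.\<close>
  have "continuous_on (sphere 0 1) g"
    unfolding continuous_on_def tendsto_rsphere_iff[where f=g]
  proof
    fix u :: "complex \<times> real" assume u: "u \<in> sphere 0 1"
    show "((\<lambda>x. stereo (g x)) \<longlongrightarrow> stereo (g u)) (at u within sphere 0 1)"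
    proof (rule Lim_transform_within[of "\<lambda>x. x" _ _ _ 1])
      show "((\<lambda>x. x) \<longlongrightarrow> stereo (g u)) (at u within sphere 0 1)"
        using u sg by simp
    qed (use sg in auto)
  qed
  then have "compact (g ` sphere 0 1)" by (intro compact_continuous_image) auto
  moreover have "g ` sphere 0 1 = UNIV"
  proof -
    have "g (stereo x) = x" for x
      using sg[OF norm_stereo] stereo_inject by blast
    then have "x \<in> g ` sphere 0 1" for x
      by (metis image_eqI mem_sphere_0 norm_stereo)
    then show ?thesis by blast
  qed
  ultimately show ?thesis by simp
qed

lemma compact_rsphere_closed: "closed (K :: rsphere set) \<Longrightarrow> compact K"
  using compact_Int_closed[OF compact_rsphere, of K] by simp

section \<open>Neighbourhoods of infinity and continuity of polynomial maps\<close>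

definition outer :: "real \<Rightarrow> rsphere set" where
  "outer c = insert Infty (Fin ` {z. c < norm z})"

lemma outer_eq: "outer c = - Fin ` cball 0 c"
proof (rule set_eqI)
  show "x \<in> outer c \<longleftrightarrow> x \<in> - Fin ` cball 0 c" for x
    by (cases x) (auto simp: outer_def image_iff not_le)
qed

lemma Infty_in_outer [simp]: "Infty \<in> outer c"
  by (simp add: outer_def)

lemma open_outer: "open (outer c)"
  unfolding outer_eq by (intro open_Compl compact_imp_closed compact_Fin_image) auto

definition couter :: "real \<Rightarrow> rsphere set" where
  "couter c = insert Infty (Fin ` {z. c \<le> norm z})"

lemma couter_eq: "couter c = - Fin ` ball 0 c"
proof (rule set_eqI)
  show "x \<in> couter c \<longleftrightarrow> x \<in> - Fin ` ball 0 c" for x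
    by (cases x) (auto simp: couter_def image_iff not_less)
qed

lemma compact_couter: "compact (couter c)"
proof -
  have "closed (couter c)" unfolding couter_eq by (intro closed_Compl open_Fin_image) auto
  then show ?thesis by (rule compact_rsphere_closed)
qed

text \<open>The sets \<open>outer c\<close> form a neighbourhood base at \<open>Infty\<close>: the
  complement of an open neighbourhood is a compact, hence bounded, part of the plane.\<close>

lemma tendsto_Infty_iff: "(f \<longlongrightarrow> Infty) F \<longleftrightarrow> (\<forall>c. \<forall>\<^sub>F x in F. f x \<in> outer c)"
proof
  assume "(f \<longlongrightarrow> Infty) F"
  then show "\<forall>c. \<forall>\<^sub>F x in F. f x \<in> outer c"
    by (auto intro: topological_tendstoD open_outer)
next
  assume R: "\<forall>c. \<forall>\<^sub>F x in F. f x \<in> outer c"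
  show "(f \<longlongrightarrow> Infty) F"
  proof (rule topological_tendstoI)
    fix S assume S: "open S" "Infty \<in> S"
    then have "compact (- S)" by (intro compact_rsphere_closed closed_Compl)
    moreover have "- S \<subseteq> range Fin" using S by (auto simp: range_Fin)
    ultimately have "bounded (Fin -` (- S))" using compact_Fin_vimage compact_imp_bounded by blast
    then obtain c where "\<forall>z\<in>Fin -` (- S). norm z \<le> c"
      unfolding bounded_iff by blast
    then have "Fin -` (- S) \<subseteq> cball 0 c" by auto
    then have "- S \<subseteq> Fin ` cball 0 c" using \<open>- S \<subseteq> range Fin\<close> by blast
    then have "outer c \<subseteq> S" unfolding outer_eq by blast
    then show "\<forall>\<^sub>F x in F. f x \<in> S"
      by (intro eventually_mono[OF R[rule_format, of c]]) (rule subsetD)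
  qed
qed

lemma poly_large:
  fixes p :: "complex poly"
  assumes "degree p \<ge> 1"
  obtains b where "\<forall>z. b \<le> norm z \<longrightarrow> c < norm (poly p z)"
proof -
  have "filterlim (poly p) at_infinity at_infinity"
    using assms by (intro filterlim_poly_at_infinity) auto
  then have "\<forall>\<^sub>F z in at_infinity. c < norm (poly p z)"
    unfolding filterlim_at_infinity_conv_norm_at_top filterlim_at_top_dense by blast
  then show ?thesis using that unfolding eventually_at_infinity by blast
qed

text \<open>The degree matters only at \<open>Infty\<close>: \<open>poly_map\<close> fixes
  \<open>Infty\<close> even for a constant polynomial, which would make it jump there.\<close>

lemma continuous_on_poly_map:
  assumes "degree p \<ge> 1"
  shows "continuous_on S (poly_map p)"
proof (rule continuous_on_subset[OF _ subset_UNIV])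
  have "continuous_on (range Fin) (\<lambda>x. Fin (poly p (the_fin x)))"
    by (intro continuous_intros continuous_on_the_fin)
  moreover have "Fin (poly p (the_fin x)) = poly_map p x" if "x \<in> range Fin" for x
    using that by (cases x) (simp_all add: range_Fin)
  ultimately have "continuous_on (range Fin) (poly_map p)"
    using continuous_on_eq by blast
  moreover have o: "open (range Fin)" by (rule open_Fin_image[OF open_UNIV])
  ultimately have 1: "isCont (poly_map p) (Fin z)" for z
    by (simp add: continuous_on_eq_continuous_at)
  have 2: "isCont (poly_map p) Infty"
    unfolding isCont_def poly_map.simps tendsto_Infty_iff
  proof
    fix c
    obtain b where b: "\<forall>z. b \<le> norm z \<longrightarrow> c < norm (poly p z)"
      using assms by (rule poly_large)
    have "x \<in> outer b \<Longrightarrow> poly_map p x \<in> outer c" for x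
      using b by (auto simp: outer_def)
    moreover have "\<forall>\<^sub>F x in at Infty. x \<in> outer b"
      unfolding eventually_at_topological using open_outer Infty_in_outer by blast
    ultimately show "\<forall>\<^sub>F x in at Infty. poly_map p x \<in> outer c"
      by (rule eventually_mono[rotated])
  qed
  have "isCont (poly_map p) x" for x
    using 1 2 by (cases x) simp_all
  then show "continuous_on UNIV (poly_map p)"
    by (simp add: continuous_at_imp_continuous_on)
qed

lemma poly_map_pcompose: "poly_map (pcompose p q) = poly_map p \<circ> poly_map q"
proof
  show "poly_map (pcompose p q) x = (poly_map p \<circ> poly_map q) x" for x
    by (cases x) (simp_all add: poly_pcompose)
qed

section \<open>Normal families on the sphere\<close>

text \<open>All values, including those of the limit, stay in \<open>cball 0 M\<close>, where
  \<open>Fin\<close> is uniformly continuous by compactness. This turns Euclidean convergence into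
  spherical convergence.\<close>

lemma uniform_limit_Fin:
  assumes lim: "uniform_limit K f l sequentially"
    and bd: "\<And>n x. x \<in> K \<Longrightarrow> norm (f n x) \<le> M"
  shows "uniform_limit K (\<lambda>n x. Fin (f n x)) (\<lambda>x. Fin (l x)) sequentially"
proof -
  have l: "norm (l x) \<le> M" if "x \<in> K" for x
  proof (rule tendsto_upperbound)
    show "(\<lambda>n. norm (f n x)) \<longlonglongrightarrow> norm (l x)"
      by (intro tendsto_norm tendsto_uniform_limitI[OF lim that])
  qed (use bd[OF that] in auto)
  have uc: "uniformly_continuous_on (cball 0 M) Fin"
    by (intro compact_uniformly_continuous continuous_intros) auto
  show ?thesis
    unfolding uniform_limit_iff
  proof (intro allI impI)
    fix e :: real assume "e > 0"
    then obtain d where d: "d > 0"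
        "\<And>a b. a \<in> cball 0 M \<Longrightarrow> b \<in> cball 0 M \<Longrightarrow> dist b a < d \<Longrightarrow> dist (Fin b) (Fin a) < e"
      using uc unfolding uniformly_continuous_on_def by meson
    then have "\<forall>\<^sub>F n in sequentially. \<forall>x\<in>K. dist (f n x) (l x) < d"
      using lim unfolding uniform_limit_iff by blast
    then show "\<forall>\<^sub>F n in sequentially. \<forall>x\<in>K. dist (Fin (f n x)) (Fin (l x)) < e"
      by (rule eventually_mono) (use d(2) bd l in auto)
  qed
qed

text \<open>Montel's theorem, carried over to the sphere. It covers the inner disc directly and,
  after inversion, the neighbourhood of infinity.\<close>

lemma normal_family_on_bounded:
  assumes "open U"
    and G: "\<And>g. g \<in> G \<Longrightarrow> \<exists>f. f holomorphic_on U \<and> (\<forall>z\<in>U. norm (f z) \<le> M \<and> g (Fin z) = Fin (f z))"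
  shows "normal_family_on G (Fin ` U)"
  unfolding normal_family_on_def
proof (intro allI impI)
  fix g :: "nat \<Rightarrow> rsphere \<Rightarrow> rsphere" assume "range g \<subseteq> G"
  then have "\<forall>n. \<exists>f. f holomorphic_on U \<and> (\<forall>z\<in>U. norm (f z) \<le> M \<and> g n (Fin z) = Fin (f z))"
    using G by blast
  then obtain f where f0: "\<forall>n. f n holomorphic_on U \<and> (\<forall>z\<in>U. norm (f n z) \<le> M \<and> g n (Fin z) = Fin (f n z))"
    by (rule choice[THEN exE])
  then have f: "\<And>n. f n holomorphic_on U" "\<And>n z. z \<in> U \<Longrightarrow> norm (f n z) \<le> M"
      "\<And>n z. z \<in> U \<Longrightarrow> g n (Fin z) = Fin (f n z)"
    by blast+
  have bd: "\<exists>B. \<forall>h\<in>range f. \<forall>z\<in>K. norm (h z) \<le> B" if "K \<subseteq> U" for K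
    using f(2) that by (intro exI[of _ M]) blast
  have hol: "h holomorphic_on U" if "h \<in> range f" for h
    using f(1) that by blast
  have "\<exists>r l. strict_mono r \<and> (\<forall>K. compact K \<and> K \<subseteq> U \<longrightarrow> uniform_limit K (f \<circ> r) l sequentially)"
  proof (rule Montel[OF \<open>open U\<close> hol bd order_refl])
    fix l and r :: "nat \<Rightarrow> nat"
    assume "strict_mono r" "\<And>K. compact K \<Longrightarrow> K \<subseteq> U \<Longrightarrow> uniform_limit K (f \<circ> r) l sequentially"
    then show ?thesis by blast
  qed auto
  then obtain r l where r: "strict_mono (r :: nat \<Rightarrow> nat)"
    and l: "\<And>K. compact K \<Longrightarrow> K \<subseteq> U \<Longrightarrow> uniform_limit K (f \<circ> r) l sequentially"
    by blast
  have "uniform_limit K (\<lambda>n. g (r n)) (\<lambda>x. Fin (l (the_fin x))) sequentially"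
    if K: "compact K" "K \<subseteq> Fin ` U" for K
  proof -
    have KU: "Fin -` K \<subseteq> U" "compact (Fin -` K)"
      using K by (auto intro!: compact_Fin_vimage)
    have u: "uniform_limit (Fin -` K) (\<lambda>n z. Fin (f (r n) z)) (\<lambda>z. Fin (l z)) sequentially"
      using l[OF KU(2,1)] f(2) KU by (intro uniform_limit_Fin[of _ _ _ M]) (auto simp: o_def)
    show ?thesis
      unfolding uniform_limit_iff
    proof (intro allI impI)
      fix e :: real assume "e > 0"
      with u have "\<forall>\<^sub>F n in sequentially. \<forall>z\<in>Fin -` K. dist (Fin (f (r n) z)) (Fin (l z)) < e"
        unfolding uniform_limit_iff by blast
      then show "\<forall>\<^sub>F n in sequentially. \<forall>x\<in>K. dist (g (r n) x) (Fin (l (the_fin x))) < e"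
      proof (rule eventually_mono, intro ballI)
        fix n x assume D: "\<forall>z\<in>Fin -` K. dist (Fin (f (r n) z)) (Fin (l z)) < e" and x: "x \<in> K"
        obtain z where z: "x = Fin z" "z \<in> U" using x K by blast
        then show "dist (g (r n) x) (Fin (l (the_fin x))) < e"
          using D x f(3) by auto
      qed
    qed
  qed
  then show "\<exists>r l. strict_mono r \<and> (\<forall>K. compact K \<and> K \<subseteq> Fin ` U \<longrightarrow>
        uniform_limit K (\<lambda>n. g (r n)) l sequentially)"
    using r by blast
qed

text \<open>The inversion 1/z, exchanging 0 and \<open>Infty\<close>. Being an isometry, it carries
  normality near \<open>Infty\<close> to normality near 0, where Montel's theorem applies.\<close>

definition sinv :: "rsphere \<Rightarrow> rsphere" where
  "sinv x = (case x of Fin z \<Rightarrow> if z = 0 then Infty else Fin (inverse z) | Infty \<Rightarrow> Fin 0)"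

lemma sinv_sinv [simp]: "sinv (sinv x) = x"
  by (cases x) (auto simp: sinv_def)

text \<open>On the unit sphere, inversion is the half turn about the real horizontal axis; hence it
  is an isometry.\<close>

lemma stereo_sinv: "stereo (sinv x) = (cnj (fst (stereo x)), - snd (stereo x))"
proof (cases x)
  case (Fin z)
  show ?thesis
  proof (cases "z = 0")
    case False
    define n where "n = (cmod z)\<^sup>2"
    have n: "n > 0" using False by (simp add: n_def)
    have "z * cnj z = of_real n" by (simp only: n_def complex_norm_square)
    then have i: "inverse z = cnj z /\<^sub>R n"
      using False n by (simp add: scaleR_conv_of_real field_simps)
    have "(cmod (inverse z))\<^sup>2 = inverse n" by (simp add: n_def norm_inverse power_inverse)
    then have "stereo (Fin (inverse z)) = ((2 / (1 + inverse n)) *\<^sub>R inverse z, (inverse n - 1) / (inverse n + 1))"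
      by (simp del: norm_inverse)
    also have "(2 / (1 + inverse n)) *\<^sub>R inverse z = (2 / (1 + n)) *\<^sub>R cnj z"
      unfolding i using n by (simp add: divide_simps)
    also have "(inverse n - 1) / (inverse n + 1) = - ((n - 1) / (n + 1))"
      using n by (simp add: divide_simps)
    finally show ?thesis
      using False by (simp add: Fin sinv_def n_def)
  qed (simp add: Fin sinv_def)
qed (simp add: sinv_def)

lemma dist_sinv [simp]: "dist (sinv x) (sinv y) = dist x y"
  by (simp add: dist_rsphere_def stereo_sinv inner_prod_def inner_complex_def)

lemma continuous_on_sinv: "continuous_on S sinv"
  unfolding continuous_on_iff by (auto simp only: dist_sinv)

lemma normal_family_onE:
  fixes f :: "nat \<Rightarrow> rsphere \<Rightarrow> rsphere"
  assumes "normal_family_on G U" "range f \<subseteq> G"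
  obtains r l where "strict_mono (r :: nat \<Rightarrow> nat)"
    "\<forall>K. compact K \<and> K \<subseteq> U \<longrightarrow> uniform_limit K (\<lambda>n. f (r n)) l sequentially"
  using assms(1)[unfolded normal_family_on_def, THEN spec, THEN mp, OF assms(2)] by blast

lemma normal_family_on_sinv:
  assumes "normal_family_on ((\<lambda>g. sinv \<circ> g \<circ> sinv) ` G) (sinv ` U)"
  shows "normal_family_on G U"
  unfolding normal_family_on_def
proof (intro allI impI)
  fix f :: "nat \<Rightarrow> rsphere \<Rightarrow> rsphere" assume f: "range f \<subseteq> G"
  have "range (\<lambda>n. sinv \<circ> f n \<circ> sinv) \<subseteq> (\<lambda>g. sinv \<circ> g \<circ> sinv) ` G"
    using f by blast
  then obtain r l where r: "strict_mono (r :: nat \<Rightarrow> nat)"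
    and l: "\<forall>K. compact K \<and> K \<subseteq> sinv ` U \<longrightarrow> uniform_limit K (\<lambda>n. sinv \<circ> f (r n) \<circ> sinv) l sequentially"
    by (rule normal_family_onE[OF assms])
  have "uniform_limit K (\<lambda>n. f (r n)) (\<lambda>x. sinv (l (sinv x))) sequentially"
    if K: "compact K" "K \<subseteq> U" for K
  proof -
    have "compact (sinv ` K)" "sinv ` K \<subseteq> sinv ` U"
      using K continuous_on_sinv by (auto intro: compact_continuous_image)
    then have u: "uniform_limit (sinv ` K) (\<lambda>n. sinv \<circ> f (r n) \<circ> sinv) l sequentially"
      using l by blast
    have "dist (f (r n) x) (sinv (l (sinv x))) = dist ((sinv \<circ> f (r n) \<circ> sinv) (sinv x)) (l (sinv x))" for n x
      using dist_sinv[of "sinv (f (r n) x)" "l (sinv x)"] by simp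
    then show ?thesis
      using u unfolding uniform_limit_iff by (simp only: ball_simps)
  qed
  then show "\<exists>r l. strict_mono r \<and> (\<forall>K. compact K \<and> K \<subseteq> U \<longrightarrow> uniform_limit K (\<lambda>n. f (r n)) l sequentially)"
    using r by blast
qed

text \<open>In the coordinate 1/z the maps send the disc of radius 1/R into itself, so they are
  uniformly bounded there.\<close>

lemma normal_family_on_outer:
  assumes R: "R > 0"
    and G: "\<And>g. g \<in> G \<Longrightarrow> \<exists>p. g = poly_map p \<and> degree p \<ge> 1 \<and> (\<forall>z. R < norm z \<longrightarrow> R < norm (poly p z))"
  shows "normal_family_on G (outer R)"
proof (rule normal_family_on_sinv)
  let ?U = "ball (0::complex) (1 / R)"
  have U: "sinv ` outer R = Fin ` ?U"
  proof -
    have *: "sinv x \<in> Fin ` ?U" if "x \<in> outer R" for x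
    proof (cases x)
      case (Fin z)
      then have "R < norm z" "z \<noteq> 0" using that R by (auto simp: outer_def)
      then have "inverse z \<in> ?U" using R by (simp add: norm_inverse norm_divide field_simps)
      then show ?thesis using \<open>z \<noteq> 0\<close> by (simp add: Fin sinv_def)
    qed (use R in \<open>simp add: sinv_def\<close>)
    have "x \<in> sinv ` outer R" if x: "x \<in> Fin ` ?U" for x
    proof (rule image_eqI[of _ _ "sinv x"])
      obtain u where u: "x = Fin u" "norm u < 1 / R" using x by auto
      then have "R < norm (inverse u)" if "u \<noteq> 0"
        using R that by (simp add: norm_inverse norm_divide field_simps)
      then show "sinv x \<in> outer R"
        by (auto simp: u sinv_def outer_def simp del: norm_inverse)
    qed simp
    with * show ?thesis by blast
  qed
  show "normal_family_on ((\<lambda>g. sinv \<circ> g \<circ> sinv) ` G) (sinv ` outer R)"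
    unfolding U
  proof (rule normal_family_on_bounded[of _ _ "1 / R"])
    fix h assume "h \<in> (\<lambda>g. sinv \<circ> g \<circ> sinv) ` G"
    then obtain p where h: "h = sinv \<circ> poly_map p \<circ> sinv" and deg: "degree p \<ge> 1" and
       p: "\<And>z. R < norm z \<Longrightarrow> R < norm (poly p z)" using G by blast
    \<comment> \<open>The value 0 at the origin is the limit of the formula, since \<open>p\<close>
      has a pole at infinity; the singularity is therefore removable.\<close>
    define f where "f u = (if u = 0 then 0 else inverse (poly p (inverse u)))" for u
    have big: "R < norm (poly p (inverse u))" if "u \<in> ?U" "u \<noteq> 0" for u
      using that R by (intro p) (simp add: norm_inverse norm_divide field_simps)
    then have nz: "poly p (inverse u) \<noteq> 0" if "u \<in> ?U" "u \<noteq> 0" for u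
      using that R by force
    have bd: "norm (f u) \<le> 1 / R" if "u \<in> ?U" for u
    proof (cases "u = 0")
      case False
      have "inverse (norm (poly p (inverse u))) \<le> inverse R"
        using big[OF that False] R by (intro le_imp_inverse_le) auto
      then show ?thesis using False by (simp add: f_def norm_inverse inverse_eq_divide[of R])
    qed (use R in \<open>simp add: f_def\<close>)
    have hf: "h (Fin u) = Fin (f u)" if "u \<in> ?U" for u
      using nz[OF that] by (simp add: h sinv_def f_def)
    have "f holomorphic_on ?U"
    proof (rule no_isolated_singularity[of _ _ "{0}"])
      have hol: "f holomorphic_on ?U - {0}"
      proof (rule holomorphic_transform)
        show "(\<lambda>u. inverse (poly p (inverse u))) holomorphic_on ?U - {0}"
          using nz by (intro holomorphic_intros) auto
      qed (auto simp: f_def)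
      then show "f holomorphic_on ?U - {0}" .
      have "(f \<longlongrightarrow> 0) (at 0)"
      proof -
        have "filterlim (\<lambda>u. poly p (inverse u)) at_infinity (at 0)"
          using deg by (intro filterlim_compose[OF filterlim_poly_at_infinity] filterlim_inverse_at_infinity) auto
        then have "((\<lambda>u. inverse (poly p (inverse u))) \<longlongrightarrow> 0) (at 0)"
          by (rule filterlim_compose[OF tendsto_inverse_0])
        then show ?thesis
          by (rule Lim_transform_eventually) (auto simp: f_def eventually_at_filter)
      qed
      then have "isCont f 0" by (simp add: isCont_def f_def)
      moreover have "isCont f u" if "u \<in> ?U - {0}" for u
        using continuous_on_eq_continuous_at[OF open_delete[OF open_ball], THEN iffD1, rule_format,
            OF holomorphic_on_imp_continuous_on[OF hol] that] .
      ultimately show "continuous_on ?U f"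
        by (intro continuous_at_imp_continuous_on) blast
    qed auto
    then show "\<exists>f. f holomorphic_on ?U \<and> (\<forall>z\<in>?U. norm (f z) \<le> 1 / R \<and> h (Fin z) = Fin (f z))"
      using bd hf by blast
  qed auto
qed

section \<open>The Julia set as a limit set\<close>

text \<open>Splits off the generator that is applied first, whereas the induction rule may cut a
  word anywhere.\<close>

lemma sgen_cases:
  assumes "f \<in> sgen H"
  obtains h where "h \<in> H" "f = h \<or> (\<exists>g\<in>sgen H. f = g \<circ> h)"
  using assms
proof (induction arbitrary: thesis)
  case (base h)
  then show ?case by blast
next
  case (comp f g)
  obtain h where h: "h \<in> H" "g = h \<or> (\<exists>g'\<in>sgen H. g = g' \<circ> h)"
    using comp.IH(2) by blast
  show ?case
  proof (rule comp.prems[OF h(1)])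
    have "\<exists>g'\<in>sgen H. f \<circ> g = g' \<circ> h"
    proof (cases "g = h")
      case False
      then obtain g' where "g' \<in> sgen H" "g = g' \<circ> h" using h(2) by blast
      then show ?thesis using comp.hyps(1) by (intro bexI[of _ "f \<circ> g'"]) (auto intro: sgen.comp)
    qed (use comp.hyps(1) in auto)
    then show "f \<circ> g = h \<or> (\<exists>g'\<in>sgen H. f \<circ> g = g' \<circ> h)" by blast
  qed
qed

text \<open>As \<open>H\<close> is finite, any sequence in the semigroup has a subsequence whose
  members all apply the same generator \<open>h\<close> first. The remaining factors are normal near
  \<open>h x\<close>, and composing with \<open>h\<close> keeps the convergence. Finiteness also
  makes \<open>V\<close> open.\<close>

lemma Fatou_preimage:
  assumes fin: "finite H" and cont: "\<And>h. h \<in> H \<Longrightarrow> continuous_on UNIV h"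
    and hx: "\<And>h. h \<in> H \<Longrightarrow> h x \<in> Fatou (sgen H)"
  shows "x \<in> Fatou (sgen H)"
proof -
  have "\<forall>h\<in>H. \<exists>U. open U \<and> h x \<in> U \<and> normal_family_on (sgen H) U"
    using hx unfolding Fatou_def by blast
  from bchoice[OF this] obtain U where
    U: "\<And>h. h \<in> H \<Longrightarrow> open (U h)" "\<And>h. h \<in> H \<Longrightarrow> h x \<in> U h"
       "\<And>h. h \<in> H \<Longrightarrow> normal_family_on (sgen H) (U h)"
    by blast
  define V where "V = (\<Inter>h\<in>H. h -` U h)"
  have "open V" unfolding V_def using fin cont U(1)
    by (intro open_INT ballI open_vimage) auto
  moreover have "x \<in> V" using U(2) by (auto simp: V_def)
  moreover have "normal_family_on (sgen H) V"
    unfolding normal_family_on_def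
  proof (intro allI impI)
    fix f :: "nat \<Rightarrow> rsphere \<Rightarrow> rsphere" assume f: "range f \<subseteq> sgen H"
    have "\<forall>n. \<exists>h. h \<in> H \<and> (f n = h \<or> (\<exists>g\<in>sgen H. f n = g \<circ> h))"
      using f sgen_cases by (metis range_subsetD)
    from choice[OF this] obtain h where
      h: "\<And>n. h n \<in> H" "\<And>n. f n = h n \<or> (\<exists>g\<in>sgen H. f n = g \<circ> h n)"
      by blast
    \<comment> \<open>The pigeonhole must also fix whether a member is a bare generator, since such
      a member has no remaining factor.\<close>
    define c where "c n = (h n, f n = h n)" for n
    have "finite (c ` UNIV)"
      by (rule finite_subset[of _ "H \<times> UNIV"]) (use h fin in \<open>auto simp: c_def\<close>)
    from pigeonhole_infinite[OF infinite_UNIV_nat this] obtain n0 where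
      "infinite {n \<in> UNIV. c n = c n0}" by blast
    from infinite_enumerate[OF this] obtain s :: "nat \<Rightarrow> nat" where
      s: "strict_mono s" "\<And>n. c (s n) = c n0" by blast
    show "\<exists>r l. strict_mono r \<and> (\<forall>K. compact K \<and> K \<subseteq> V \<longrightarrow> uniform_limit K (\<lambda>n. f (r n)) l sequentially)"
    proof (cases "f n0 = h n0")
      case True
      then have "f (s n) = h n0" for n using s(2)[of n] by (simp add: c_def)
      then show ?thesis using s(1)
        by (intro exI[of _ s] exI[of _ "h n0"]) (simp add: uniform_limit_const)
    next
      case False
      then have "\<exists>g\<in>sgen H. f (s n) = g \<circ> h n0" for n
        using s(2)[of n] h(2)[of "s n"] by (auto simp: c_def)
      then have "\<forall>n. \<exists>g. g \<in> sgen H \<and> f (s n) = g \<circ> h n0" by blast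
      from choice[OF this] obtain g where g: "\<And>n. g n \<in> sgen H" "\<And>n. f (s n) = g n \<circ> h n0"
        by blast
      have "range g \<subseteq> sgen H" by (rule image_subsetI) (rule g(1))
      then obtain r l where
        r: "strict_mono (r :: nat \<Rightarrow> nat)" and
        l: "\<forall>K. compact K \<and> K \<subseteq> U (h n0) \<longrightarrow> uniform_limit K (\<lambda>n. g (r n)) l sequentially"
        by (rule normal_family_onE[OF U(3)[OF h(1)[of n0]]])
      have "uniform_limit K (\<lambda>n. f ((s \<circ> r) n)) (l \<circ> h n0) sequentially" if "compact K" "K \<subseteq> V" for K
      proof -
        have "compact (h n0 ` K)"
          using cont[OF h(1)[of n0]] that(1) by (intro compact_continuous_image) (auto intro: continuous_on_subset)
        moreover have "h n0 ` K \<subseteq> U (h n0)" using that(2) h(1) by (auto simp: V_def)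
        ultimately have "uniform_limit (h n0 ` K) (\<lambda>n. g (r n)) l sequentially" using l by blast
        then show ?thesis
          unfolding uniform_limit_iff by (simp add: g(2))
      qed
      then show ?thesis using strict_mono_o[OF s(1) r] by blast
    qed
  qed
  ultimately show ?thesis unfolding Fatou_def by blast
qed

section \<open>Expanding systems and their limit sets\<close>

primrec level :: "complex poly set \<Rightarrow> complex set \<Rightarrow> nat \<Rightarrow> complex set" where
  "level P D 0 = D"
| "level P D (Suc n) = (\<Union>p\<in>P. poly p -` level P D n)"

definition limset :: "complex poly set \<Rightarrow> complex set \<Rightarrow> complex set" where
  "limset P D = (\<Inter>n. level P D n)"

definition annulus :: "real \<Rightarrow> real \<Rightarrow> complex set" where
  "annulus r R = {z. r \<le> norm z \<and> norm z \<le> R}"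

lemma compact_annulus: "compact (annulus r R)"
proof -
  have "annulus r R = cball 0 R - ball 0 r" by (auto simp: annulus_def)
  then show ?thesis by (simp add: compact_diff)
qed

text \<open>\<open>inner\<close> and \<open>outer\<close> give normality off the annulus and pull
  the annulus back into itself; \<open>expanding\<close> destroys normality on the limit set.
  \<open>roots\<close> controls the critical values and the connectedness of preimages.\<close>

locale expanding_system =
  fixes P :: "complex poly set" and r R lam :: real
  assumes finite_P: "finite P" and P_ne: "P \<noteq> {}"
    and r_pos: "0 < r" and r_less_R: "r < R" and lam: "1 < lam"
    and deg: "p \<in> P \<Longrightarrow> degree p \<ge> 2"
    and inner: "p \<in> P \<Longrightarrow> norm z \<le> r \<Longrightarrow> norm (poly p z) < r"
    and outer: "p \<in> P \<Longrightarrow> R \<le> norm z \<Longrightarrow> R < norm (poly p z)"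
    and roots: "p \<in> P \<Longrightarrow> poly p z = 0 \<Longrightarrow> norm z < r"
    and expanding: "p \<in> P \<Longrightarrow> poly p z \<in> annulus r R \<Longrightarrow> lam \<le> norm (poly (pderiv p) z)"
begin

lemma vimage_annulus_subset: "p \<in> P \<Longrightarrow> poly p -` annulus r R \<subseteq> annulus r R"
  using inner outer by (force simp: annulus_def not_le dest: less_imp_le)

lemma level_subset: "level P (annulus r R) n \<subseteq> annulus r R"
  by (induction n) (use vimage_annulus_subset in auto)

lemma limset_subset: "limset P (annulus r R) \<subseteq> annulus r R"
  unfolding limset_def using level_subset by blast

lemma sgen_poly_map:
  assumes "g \<in> sgen (poly_map ` P)"
  shows "\<exists>p. g = poly_map p \<and> degree p \<ge> 2 \<and> (\<forall>z. norm z < r \<longrightarrow> norm (poly p z) < r)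
     \<and> (\<forall>z. R < norm z \<longrightarrow> R < norm (poly p z))"
  using assms
proof induction
    case (base h)
    then obtain p where "p \<in> P" "h = poly_map p" by blast
    then show ?case using deg inner outer less_imp_le by blast
  next
    case (comp f g)
    then obtain p q where "f = poly_map p" "g = poly_map q" "degree p \<ge> 2" "degree q \<ge> 2"
       "\<forall>z. norm z < r \<longrightarrow> norm (poly p z) < r" "\<forall>z. norm z < r \<longrightarrow> norm (poly q z) < r"
       "\<forall>z. R < norm z \<longrightarrow> R < norm (poly p z)" "\<forall>z. R < norm z \<longrightarrow> R < norm (poly q z)" by blast
    moreover have "2 * 1 \<le> degree p * degree q" using calculation by (intro mult_le_mono) auto
    ultimately show ?case
      by (intro exI[of _ "pcompose p q"]) (simp add: poly_map_pcompose degree_pcompose poly_pcompose)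
qed

text \<open>Off the annulus the whole semigroup is trapped in the inner disc or in the exterior,
  hence normal. A point outside level n + 1 is sent outside level n by every generator, so
  \<open>Fatou_preimage\<close> advances the induction.\<close>

lemma not_level_imp_Fatou: "x \<notin> Fin ` level P (annulus r R) n \<Longrightarrow> x \<in> Fatou (sgen (poly_map ` P))"
proof (induction n arbitrary: x)
  case 0
  show ?case
  proof (cases "x \<in> outer R")
    case True
    have "normal_family_on (sgen (poly_map ` P)) (outer R)"
    proof (rule normal_family_on_outer)
      fix g assume "g \<in> sgen (poly_map ` P)"
      then show "\<exists>p. g = poly_map p \<and> degree p \<ge> 1 \<and> (\<forall>z. R < norm z \<longrightarrow> R < norm (poly p z))"
        using sgen_poly_map[of g] by fastforce
    qed (use r_pos r_less_R in simp)
    then show ?thesis using True open_outer unfolding Fatou_def by blast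
  next
    case False
    then obtain z where z: "x = Fin z" "norm z \<le> R" unfolding outer_eq by auto
    then have "z \<notin> annulus r R" using 0 by auto
    then have "x \<in> Fin ` ball 0 r" using z by (auto simp: annulus_def)
    moreover have "normal_family_on (sgen (poly_map ` P)) (Fin ` ball 0 r)"
    proof (rule normal_family_on_bounded[of _ _ r])
      fix g assume "g \<in> sgen (poly_map ` P)"
      then obtain p where "g = poly_map p" "\<forall>z. norm z < r \<longrightarrow> norm (poly p z) < r"
        using sgen_poly_map by blast
      then show "\<exists>f. f holomorphic_on ball 0 r \<and> (\<forall>z\<in>ball 0 r. norm (f z) \<le> r \<and> g (Fin z) = Fin (f z))"
        by (intro exI[of _ "poly p"]) (auto intro!: holomorphic_intros less_imp_le)
    qed auto
    ultimately show ?thesis using open_Fin_image[OF open_ball] unfolding Fatou_def by blast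
  qed
next
  case (Suc n)
  show ?case
  proof (rule Fatou_preimage)
    fix h assume "h \<in> poly_map ` P"
    then obtain p where p: "p \<in> P" "h = poly_map p" by blast
    have "1 \<le> degree p" using deg[OF p(1)] by simp
    then show "continuous_on UNIV h" unfolding p by (rule continuous_on_poly_map)
    show "h x \<in> Fatou (sgen (poly_map ` P))"
      by (rule Suc.IH) (use Suc.prems p in \<open>cases x; auto\<close>)
  qed (simp add: finite_P)
qed

text \<open>Chain rule along a word: every intermediate image lies in the annulus because all levels
  do, so each of the n + 1 factors contributes at least \<open>lam\<close>.\<close>

lemma level_Suc_expanding:
  assumes "z \<in> level P (annulus r R) (Suc n)"
  shows "\<exists>q. poly_map q \<in> sgen (poly_map ` P) \<and> poly q z \<in> annulus r R \<and>
    lam ^ Suc n \<le> norm (poly (pderiv q) z)"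
  using assms
proof (induction n arbitrary: z)
  case 0
  then obtain p where "p \<in> P" "poly p z \<in> annulus r R" by auto
  then show ?case using expanding by (intro exI[of _ p]) (auto intro: sgen.base)
next
  case (Suc n)
  then obtain p where p: "p \<in> P" "poly p z \<in> level P (annulus r R) (Suc n)"
    unfolding level.simps(2)[of _ _ "Suc n"] by blast
  from Suc.IH[OF p(2)] obtain q where q: "poly_map q \<in> sgen (poly_map ` P)"
    "poly q (poly p z) \<in> annulus r R" "lam ^ Suc n \<le> norm (poly (pderiv q) (poly p z))" by blast
  have "poly p z \<in> annulus r R" using p(2) level_subset by blast
  then have "lam \<le> norm (poly (pderiv p) z)" by (rule expanding[OF p(1)])
  then have "lam ^ Suc n * lam \<le> norm (poly (pderiv q) (poly p z)) * norm (poly (pderiv p) z)"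
    using q(3) lam by (intro mult_mono) auto
  moreover have "poly_map (pcompose q p) \<in> sgen (poly_map ` P)"
    unfolding poly_map_pcompose using sgen.comp[OF q(1) sgen.base] p(1) by blast
  ultimately show ?case using q(2)
    by (intro exI[of _ "pcompose q p"])
       (simp add: poly_pcompose pderiv_pcompose norm_mult mult.commute)
qed

text \<open>Normality at z would keep a subsequence of the expanding words close to a continuous
  limit. Their values on a small disc about z would then be bounded, as those at z lie in the
  annulus, and Cauchy's estimate would bound derivatives that grow exponentially.\<close>

lemma limset_imp_Julia:
  assumes z: "z \<in> limset P (annulus r R)"
  shows "Fin z \<notin> Fatou (sgen (poly_map ` P))"
proof
  assume "Fin z \<in> Fatou (sgen (poly_map ` P))"
  then obtain U where U: "open U" "Fin z \<in> U" "normal_family_on (sgen (poly_map ` P)) U"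
    unfolding Fatou_def by blast
  have "\<forall>n. \<exists>q. poly_map q \<in> sgen (poly_map ` P) \<and> poly q z \<in> annulus r R \<and>
    lam ^ Suc n \<le> norm (poly (pderiv q) z)"
    using z level_Suc_expanding unfolding limset_def by blast
  from choice[OF this] obtain q where q: "\<And>n. poly_map (q n) \<in> sgen (poly_map ` P)"
    "\<And>n. poly (q n) z \<in> annulus r R" "\<And>n. lam ^ Suc n \<le> norm (poly (pderiv (q n)) z)" by blast
  have "range (\<lambda>n. poly_map (q n)) \<subseteq> sgen (poly_map ` P)" by (rule image_subsetI) (rule q(1))
  then obtain s l where s: "strict_mono (s :: nat \<Rightarrow> nat)"
    and l: "\<forall>K. compact K \<and> K \<subseteq> U \<longrightarrow> uniform_limit K (\<lambda>n. poly_map (q (s n))) l sequentially"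
    by (rule normal_family_onE[OF U(3)])
  have "open (Fin -` U)" using U(1) by (intro open_vimage continuous_intros)
  then obtain \<rho> where \<rho>: "\<rho> > 0" "cball z \<rho> \<subseteq> Fin -` U"
    using U(2) unfolding open_contains_cball by blast
  define K where "K = Fin ` cball z \<rho>"
  have K: "compact K" unfolding K_def by (rule compact_Fin_image[OF compact_cball])
  have "K \<subseteq> U" using \<rho>(2) unfolding K_def by blast
  with K have lim: "uniform_limit K (\<lambda>n. poly_map (q (s n))) l sequentially" using l by blast
  have "continuous_on K l"
  proof (rule uniform_limit_theorem[OF _ lim])
    have "continuous_on K (poly_map (q n))" for n
    proof -
      obtain p where "poly_map (q n) = poly_map p" "degree p \<ge> 2" using sgen_poly_map[OF q(1)] by blast
      then show ?thesis by (simp add: continuous_on_poly_map)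
    qed
    then show "\<forall>\<^sub>F n in sequentially. continuous_on K (poly_map (q (s n)))" by simp
  qed simp
  then have "continuous_on (cball z \<rho>) (l \<circ> Fin)"
    unfolding K_def by (rule continuous_on_compose[OF continuous_on_Fin[OF continuous_on_id]])
  then have cont: "continuous_on (cball z \<rho>) (\<lambda>w. l (Fin w))" by (simp add: o_def)
  have "compact (Fin ` annulus r R)" by (intro compact_Fin_image compact_annulus)
  moreover have "open (Fin ` ball 0 (R + 1))" by (intro open_Fin_image) auto
  moreover have "Fin ` annulus r R \<subseteq> Fin ` ball 0 (R + 1)" by (intro image_mono) (auto simp: annulus_def)
  \<comment> \<open>Spherical distance below \<open>e\<close> from the annulus forces a finite value
    of norm below \<open>R + 1\<close>. This distance is shared out in thirds: two for uniform
    convergence, one for continuity of \<open>l\<close>.\<close>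
  ultimately obtain e where e: "e > 0" "(\<Union>x\<in>Fin ` annulus r R. ball x e) \<subseteq> Fin ` ball 0 (R + 1)"
    by (rule compact_subset_open_imp_ball_epsilon_subset)
  from cont \<rho>(1) e(1) obtain d where d: "d > 0"
     "\<And>w. w \<in> cball z \<rho> \<Longrightarrow> dist w z < d \<Longrightarrow> dist (l (Fin w)) (l (Fin z)) < e / 3"
    unfolding continuous_on_iff by (metis centre_in_cball divide_pos_pos less_imp_le zero_less_numeral)
  define \<delta> where "\<delta> = min (d / 2) \<rho>"
  have \<delta>: "\<delta> > 0" "\<delta> \<le> \<rho>" "\<delta> < d" using d(1) \<rho>(1) by (auto simp: \<delta>_def)
  \<comment> \<open>\<open>(R + 1) / \<delta>\<close> is the Cauchy bound for the derivative at z,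
    to be exceeded by the expansion.\<close>
  obtain n0 where n0: "(R + 1) / \<delta> < lam ^ n0" using real_arch_pow[OF lam] by blast
  have "\<forall>\<^sub>F n in sequentially. \<forall>x\<in>K. dist (poly_map (q (s n)) x) (l x) < e / 3"
    by (rule uniform_limitD[OF lim]) (use e(1) in simp)
  from eventually_conj[OF eventually_ge_at_top[of n0] this]
  obtain n where "\<forall>m\<ge>n. n0 \<le> m \<and> (\<forall>x\<in>K. dist (poly_map (q (s m)) x) (l x) < e / 3)"
    unfolding eventually_sequentially by blast
  then have n: "n0 \<le> n" "\<And>x. x \<in> K \<Longrightarrow> dist (poly_map (q (s n)) x) (l x) < e / 3"
    by blast+
  define p where "p = q (s n)"
  have bd: "norm (poly p w) \<le> R + 1" if w: "w \<in> cball z \<delta>" for w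
  proof -
    have wK: "Fin w \<in> K" "Fin z \<in> K" "w \<in> cball z \<rho>" "dist w z < d"
      using w \<delta> \<rho>(1) by (auto simp: K_def dist_commute)
    have "dist (Fin (poly p z)) (Fin (poly p w)) < e"
      using n(2)[OF wK(1)] n(2)[OF wK(2)] d(2)[OF wK(3,4)]
        dist_triangle[of "Fin (poly p z)" "Fin (poly p w)" "l (Fin z)"]
        dist_triangle[of "l (Fin z)" "Fin (poly p w)" "l (Fin w)"]
      by (simp add: p_def dist_commute)
    then have "Fin (poly p w) \<in> Fin ` ball 0 (R + 1)"
      using e(2) q(2)[of "s n"] by (fastforce simp: p_def)
    then show ?thesis by auto
  qed
  have "norm ((deriv ^^ 1) (poly p) z) \<le> fact 1 * (R + 1) / \<delta> ^ 1"
    by (rule Cauchy_inequality) (use \<delta>(1) bd in \<open>auto intro!: holomorphic_intros continuous_intros simp: dist_norm\<close>)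
  then have "norm (poly (pderiv p) z) \<le> (R + 1) / \<delta>"
    using DERIV_imp_deriv[OF poly_DERIV, of p z] by simp
  moreover have "lam ^ n0 \<le> lam ^ Suc (s n)"
    using lam n(1) strict_mono_imp_increasing[OF s, of n] by (intro power_increasing) auto
  ultimately show False using n0 q(3)[of "s n"] by (simp add: p_def)
qed

lemma Julia_eq: "Julia (sgen (poly_map ` P)) = Fin ` limset P (annulus r R)"
proof -
  have "x \<in> Fatou (sgen (poly_map ` P))" if x: "x \<notin> Fin ` limset P (annulus r R)" for x
  proof -
    have "\<exists>n. x \<notin> Fin ` level P (annulus r R) n"
    proof (cases x)
      case (Fin z)
      then have "z \<notin> limset P (annulus r R)" using x by blast
      then show ?thesis unfolding Fin limset_def by blast
    qed auto
    then obtain n where "x \<notin> Fin ` level P (annulus r R) n" by blast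
    then show ?thesis by (rule not_level_imp_Fatou)
  qed
  then show ?thesis using limset_imp_Julia unfolding Julia_def by blast
qed

end

section \<open>Rings and their preimages\<close>

text \<open>As \<open>f\<close> is open and closed, a relatively clopen piece of the preimage has a
  clopen image in \<open>K\<close>, hence covers \<open>K\<close> and has a point over
  \<open>p\<close>. The whole fibre over \<open>p\<close> lies in the connected set
  \<open>T\<close>, so two disjoint pieces cannot exist.\<close>

lemma connected_vimage:
  fixes f :: "'a::topological_space \<Rightarrow> 'b::topological_space"
  assumes opn: "\<And>U. open U \<Longrightarrow> open (f ` U)" and clo: "\<And>C. closed C \<Longrightarrow> closed (f ` C)"
    and cont: "continuous_on UNIV f"
    and K: "connected K" "closed K" "p \<in> K"
    and T: "connected T" "T \<subseteq> f -` K" "f -` {p} \<subseteq> T"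
  shows "connected (f -` K)"
proof (rule connectedI)
  have clK: "closed (f -` K)" using K(2) cont by (simp add: closed_vimage)
  fix A B assume A: "open A" and B: "open B" and ne: "A \<inter> f -` K \<noteq> {}" "B \<inter> f -` K \<noteq> {}"
    and dis: "A \<inter> B \<inter> f -` K = {}" and cov: "f -` K \<subseteq> A \<union> B"
  have hit: "p \<in> f ` (C \<inter> f -` K)"
    if C: "open C" "open E" and ne: "C \<inter> f -` K \<noteq> {}"
      and dis: "C \<inter> E \<inter> f -` K = {}" and cov: "f -` K \<subseteq> C \<union> E" for C E
  proof -
    \<comment> \<open>Being the complement of the other piece, this piece is closed as well as
      relatively open, so both mapping hypotheses apply to it.\<close>
    have eq: "C \<inter> f -` K = f -` K - E" using dis cov by blast
    then have "closed (f ` (C \<inter> f -` K))" using clK C by (auto intro: clo closed_Diff)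
    moreover have im: "f ` (C \<inter> f -` K) = f ` C \<inter> K" by blast
    ultimately have "closedin (top_of_set K) (f ` C \<inter> K)" by (intro closed_subset) auto
    moreover have "openin (top_of_set K) (f ` C \<inter> K)"
      using opn[OF C(1)] by (simp add: openin_open_Int Int_commute)
    ultimately have "f ` C \<inter> K = {} \<or> f ` C \<inter> K = K"
      using K(1)[unfolded connected_clopen] by simp
    moreover have "f ` (C \<inter> f -` K) \<noteq> {}" using ne by simp
    ultimately have "f ` C \<inter> K = K" unfolding im by simp
    then show ?thesis unfolding im using K(3) by simp
  qed
  have "A \<inter> T \<noteq> {}" using hit[OF A B ne(1) dis cov] T(3) by blast
  moreover have "B \<inter> T \<noteq> {}" using hit[OF B A ne(2)] dis cov T(3) by blast
  ultimately show False using connectedD[OF T(1) A B] dis cov T(2) by blast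
qed

text \<open>Nonconstant polynomials are proper: the preimages of a convergent sequence stay in a
  compact set.\<close>

lemma closed_poly_image:
  fixes p :: "complex poly"
  assumes "degree p \<ge> 1" "closed C"
  shows "closed (poly p ` C)"
proof -
  have bd: "bounded (poly p -` cball 0 b)" for b
  proof -
    obtain c where c: "\<forall>z. c \<le> norm z \<longrightarrow> b < norm (poly p z)"
      using assms(1) by (rule poly_large)
    have "poly p -` cball 0 b \<subseteq> cball 0 c" using c by (force simp: not_less[symmetric])
    then show ?thesis by (rule bounded_subset[OF bounded_cball])
  qed
  show ?thesis
    unfolding closed_sequential_limits
  proof (intro allI impI, elim conjE)
    fix x l assume x: "\<forall>n. x n \<in> poly p ` C" and lim: "x \<longlonglongrightarrow> l"
    have "bounded (range x)" using lim by (rule convergent_imp_bounded)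
    then obtain b where b: "\<And>n. norm (x n) \<le> b" unfolding bounded_iff by blast
    define S where "S = C \<inter> poly p -` cball 0 b"
    have "closed S" unfolding S_def
      by (intro closed_Int assms closed_vimage continuous_intros) auto
    moreover have "bounded S" unfolding S_def by (rule bounded_subset[OF bd]) auto
    ultimately have "compact (poly p ` S)"
      by (intro compact_continuous_image continuous_intros) (simp add: compact_eq_bounded_closed)
    then have "closed (poly p ` S)" by (rule compact_imp_closed)
    moreover have "x n \<in> poly p ` S" for n
    proof -
      obtain c where c: "c \<in> C" "x n = poly p c" using x by blast
      then have "c \<in> S" using b[of n] by (simp add: S_def)
      then show ?thesis using c(2) by blast
    qed
    ultimately have "l \<in> poly p ` S" using lim closed_sequentially[of "poly p ` S" x l] by simp
    then show "l \<in> poly p ` C" by (auto simp: S_def)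
  qed
qed

lemma open_poly_image:
  fixes p :: "complex poly"
  assumes "degree p \<ge> 1" "open U"
  shows "open (poly p ` U)"
proof (rule open_mapping_thm[of "poly p" UNIV])
  show "\<not> poly p constant_on UNIV"
  proof
    assume "poly p constant_on UNIV"
    then obtain c where "\<And>z. poly p z = c" unfolding constant_on_def by blast
    then have "poly p = poly [:c:]" by auto
    then have "p = [:c:]" by (simp only: poly_eq_poly_eq_iff)
    then show False using assms by simp
  qed
qed (use assms in \<open>auto intro!: holomorphic_intros\<close>)

lemma surj_poly:
  fixes p :: "complex poly"
  assumes "degree p \<ge> 1"
  shows "\<exists>z. poly p z = c"
proof -
  have "\<not> constant (poly p)" using assms by (simp add: constant_degree)
  then have "\<not> constant (poly (p - [:c:]))" by (simp add: constant_def)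
  from fundamental_theorem_of_algebra[OF this] show ?thesis by auto
qed

text \<open>The sides \<open>U\<close> and \<open>W\<close> may each consist of many complementary
  components. Preimages and basins can thus serve as sides without any connectedness
  argument.\<close>

definition separated_by :: "real \<Rightarrow> real \<Rightarrow> complex set \<Rightarrow> complex set \<Rightarrow> complex set \<Rightarrow> bool" where
  "separated_by r R C U W \<longleftrightarrow> open U \<and> open W \<and> U \<inter> W = {} \<and> U \<union> W = - C \<and>
     ball 0 r \<subseteq> U \<and> {z. R < norm z} \<subseteq> W"

definition ring_continuum :: "real \<Rightarrow> real \<Rightarrow> complex set \<Rightarrow> bool" where
  "ring_continuum r R C \<longleftrightarrow> compact C \<and> connected C \<and> C \<subseteq> annulus r R \<and> (\<exists>U W. separated_by r R C U W)"

text \<open>In a splitting of \<open>U \<union> C\<close>, the connected set \<open>C\<close> lies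
  in one part. The other part is then contained in \<open>U\<close> and is clopen in the whole
  space, which is impossible for a nonempty proper subset.\<close>

lemma connected_Un_open_side:
  fixes C :: "'a::real_normed_vector set"
  assumes "connected C" "C \<noteq> {}" "open U" "open W" "U \<inter> W = {}" "U \<union> W = - C"
  shows "connected (U \<union> C)"
proof (rule connectedI)
  have *: False
    if A: "open A" "open B" and dis: "A \<inter> B \<inter> (U \<union> C) = {}" and cov: "U \<union> C \<subseteq> A \<union> B"
      and ne: "B \<inter> (U \<union> C) \<noteq> {}" and CA: "C \<subseteq> A" for A B
  proof -
    have mem: "x \<in> C \<longleftrightarrow> x \<notin> U \<and> x \<notin> W" for x using assms(6) by blast
    have "- (B \<inter> U) = A \<union> W"
    proof (rule set_eqI)
      show "x \<in> - (B \<inter> U) \<longleftrightarrow> x \<in> A \<union> W" for x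
        using dis cov CA assms(5) mem[of x] by blast
    qed
    moreover have "open (A \<union> W)" using A(1) assms(4) by blast
    ultimately have "closed (B \<inter> U)" by (simp add: closed_def)
    moreover have "open (B \<inter> U)" using A(2) assms(3) by blast
    ultimately have "B \<inter> U = {} \<or> B \<inter> U = UNIV" by (intro clopen[THEN iffD1] conjI)
    moreover obtain x where "x \<in> B" "x \<in> U \<union> C" using ne by blast
    then have "x \<in> B \<inter> U" using dis CA by blast
    moreover obtain y where "y \<in> C" using assms(2) by blast
    then have "y \<notin> B \<inter> U" using mem[of y] by blast
    ultimately show False by blast
  qed
  fix A B assume A: "open A" "open B" "A \<inter> (U \<union> C) \<noteq> {}" "B \<inter> (U \<union> C) \<noteq> {}"
    "A \<inter> B \<inter> (U \<union> C) = {}" "U \<union> C \<subseteq> A \<union> B"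
  have "C \<subseteq> A \<or> C \<subseteq> B"
    using connectedD[OF assms(1) A(1,2)] A(5,6) by blast
  then show False using *[of A B] *[of B A] A by blast
qed

lemma ring_nonempty:
  assumes "ring_continuum r R C" "r > 0"
  shows "C \<noteq> {}"
proof
  assume "C = {}"
  then obtain U W where S: "open U" "open W" "U \<inter> W = {}" "U \<union> W = (UNIV :: complex set)"
      "ball 0 r \<subseteq> U" "{z. R < norm z} \<subseteq> W"
    using assms unfolding ring_continuum_def separated_by_def by auto
  have "- U = W" using S(3,4) by blast
  then have "closed U" using S(2) by (simp add: closed_def)
  then have "U = {} \<or> U = UNIV" using S(1) by (intro clopen[THEN iffD1] conjI)
  moreover have "0 \<in> U" using S(5) assms(2) by auto
  moreover have "complex_of_real (\<bar>R\<bar> + 1) \<in> {z. R < norm z}" by (simp del: of_real_add)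
  then have "complex_of_real (\<bar>R\<bar> + 1) \<in> W" using S(6) by blast
  ultimately show False using S(3) by blast
qed

text \<open>The preimage of a ring is the intersection of the connected preimages of its two closed sides.\<close>

lemma ring_vimage:
  assumes C: "ring_continuum r R C" and r: "0 < r" "r < R"
    and deg: "degree p \<ge> 1"
    and inner: "\<And>z. norm z \<le> r \<Longrightarrow> norm (poly p z) < r"
    and outer: "\<And>z. R \<le> norm z \<Longrightarrow> R < norm (poly p z)"
    and roots: "\<And>z. poly p z = 0 \<Longrightarrow> norm z < r"
  shows "ring_continuum r R (poly p -` C)"
proof -
  let ?f = "poly p"
  have ne: "C \<noteq> {}" using ring_nonempty C r by blast
  obtain U W where S: "open U" "open W" "U \<inter> W = {}" "U \<union> W = - C"
      "ball 0 r \<subseteq> U" "{z. R < norm z} \<subseteq> W"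
    using C unfolding ring_continuum_def separated_by_def by blast
  have C': "compact C" "connected C" "C \<subseteq> annulus r R" using C unfolding ring_continuum_def by auto
  have cont: "continuous_on UNIV ?f" by (intro continuous_intros)
  have sub: "?f -` C \<subseteq> annulus r R"
  proof
    fix z assume "z \<in> ?f -` C"
    then have "r \<le> norm (?f z)" "norm (?f z) \<le> R" using C'(3) by (auto simp: annulus_def)
    then show "z \<in> annulus r R" using inner[of z] outer[of z] by (force simp: annulus_def)
  qed
  have "closed (?f -` C)" using compact_imp_closed[OF C'(1)] cont by (simp add: closed_vimage)
  moreover have "bounded (?f -` C)"
    by (rule bounded_subset[OF bounded_cball[of 0 R]]) (use sub in \<open>auto simp: annulus_def\<close>)
  ultimately have comp: "compact (?f -` C)" by (simp add: compact_eq_bounded_closed)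
  have cW: "- W = U \<union> C" and cU: "- U = W \<union> C" using S(3,4) by blast+
  \<comment> \<open>The fibre over 0 is the set of zeros; it lies in \<open>ball 0 r\<close>, which
    is connected and mapped into \<open>U\<close>.\<close>
  have con1: "connected (?f -` (U \<union> C))"
  proof (rule connected_vimage[where p=0 and T="ball 0 r"])
    show "connected (U \<union> C)" by (rule connected_Un_open_side[OF C'(2) ne S(1,2,3,4)])
    show "closed (U \<union> C)" using S(2) by (simp flip: cW add: closed_Compl)
    show "0 \<in> U \<union> C" using S(5) r by auto
    show "ball 0 r \<subseteq> ?f -` (U \<union> C)" using S(5) inner by fastforce
    show "?f -` {0} \<subseteq> ball 0 r" using roots by auto
  qed (use deg cont open_poly_image closed_poly_image in auto)
  have con2: "connected (?f -` (W \<union> C))"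
  proof -
    have "compact (?f ` cball 0 R)" by (intro compact_continuous_image continuous_intros) auto
    then have "bounded (?f ` cball 0 R)" by (rule compact_imp_bounded)
    then obtain b where "\<forall>y\<in>?f ` cball 0 R. norm y \<le> b"
      unfolding bounded_iff by (rule exE)
    then have b: "\<And>z. z \<in> cball 0 R \<Longrightarrow> norm (?f z) \<le> b" by simp
    \<comment> \<open>This value exceeds the maximum of the polynomial on \<open>cball 0 R\<close>,
      so its whole fibre lies in the connected exterior.\<close>
    define w where "w = complex_of_real (max \<bar>b\<bar> R + 1)"
    have w: "norm w > b" "norm w > R" using r unfolding w_def norm_of_real by auto
    show ?thesis
    proof (rule connected_vimage[where p=w and T="{z. R < norm z}"])
      show "connected (W \<union> C)"
        by (rule connected_Un_open_side[OF C'(2) ne S(2,1)]) (use S(3,4) in auto)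
      show "closed (W \<union> C)" using S(1) by (simp flip: cU add: closed_Compl)
      show "w \<in> W \<union> C" using S(6) w by auto
      show "{z. R < norm z} \<subseteq> ?f -` (W \<union> C)" using S(6) outer less_imp_le by blast
      have "R < norm z" if "?f z = w" for z using b[of z] w(1) that by force
      then show "?f -` {w} \<subseteq> {z. R < norm z}" by blast
      have "{z::complex. R < norm z} = - cball 0 R" by auto
      then show "connected {z::complex. R < norm z}"
        using connected_complement_bounded_convex[of "cball (0::complex) R"] by simp
    qed (use deg cont open_poly_image closed_poly_image in auto)
  qed
  \<comment> \<open>Unicoherence: the two preimages are closed and connected and cover the plane, so
    their intersection is connected.\<close>
  have "connected (?f -` (U \<union> C) \<inter> ?f -` (W \<union> C))"
  proof (rule unicoherentD[OF unicoherent_UNIV con1 con2])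
    show "UNIV = ?f -` (U \<union> C) \<union> ?f -` (W \<union> C)" using S(4) by blast
    have "closed (?f -` (U \<union> C))" using S(2) cont by (intro closed_vimage) (simp_all flip: cW add: closed_Compl)
    then show "closedin (top_of_set UNIV) (?f -` (U \<union> C))" by simp
    have "closed (?f -` (W \<union> C))" using S(1) cont by (intro closed_vimage) (simp_all flip: cU add: closed_Compl)
    then show "closedin (top_of_set UNIV) (?f -` (W \<union> C))" by simp
  qed
  moreover have "?f -` (U \<union> C) \<inter> ?f -` (W \<union> C) = ?f -` C" using S(3) by blast
  ultimately have "connected (?f -` C)" by simp
  moreover have "separated_by r R (?f -` C) (?f -` U) (?f -` W)"
    unfolding separated_by_def
  proof (intro conjI)
    show "open (?f -` U)" "open (?f -` W)" using S(1,2) cont by (simp_all add: open_vimage)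
    show "?f -` U \<inter> ?f -` W = {}" using S(3) by blast
    show "?f -` U \<union> ?f -` W = - ?f -` C" using S(4) by blast
    show "ball 0 r \<subseteq> ?f -` U" using S(5) inner by fastforce
    show "{z. R < norm z} \<subseteq> ?f -` W" using S(6) outer less_imp_le by blast
  qed
  ultimately show ?thesis using comp sub unfolding ring_continuum_def by blast
qed

text \<open>Removing the larger continuum from both sides leaves a separation, because that
  continuum meets neither the inner disc nor the exterior.\<close>

lemma ring_mono:
  assumes "ring_continuum r R C" "C \<subseteq> C'" "compact C'" "connected C'" "C' \<subseteq> annulus r R"
  shows "ring_continuum r R C'"
proof -
  obtain U W where S: "open U" "open W" "U \<inter> W = {}" "U \<union> W = - C"
      "ball 0 r \<subseteq> U" "{z. R < norm z} \<subseteq> W"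
    using assms(1) unfolding ring_continuum_def separated_by_def by blast
  have o: "open (- C')" using assms(3) by (simp add: compact_imp_closed open_Compl)
  have "separated_by r R C' (U \<inter> - C') (W \<inter> - C')"
    unfolding separated_by_def
  proof (intro conjI)
    show "open (U \<inter> - C')" "open (W \<inter> - C')" using S(1,2) o by auto
    show "(U \<inter> - C') \<inter> (W \<inter> - C') = {}" using S(3) by blast
    show "U \<inter> - C' \<union> W \<inter> - C' = - C'" using S(4) assms(2) by blast
    show "ball 0 r \<subseteq> U \<inter> - C'" using S(5) assms(5) by (auto simp: annulus_def)
    show "{z. R < norm z} \<subseteq> W \<inter> - C'" using S(6) assms(5) by (auto simp: annulus_def)
  qed
  then show ?thesis using assms unfolding ring_continuum_def by blast
qed

lemma connected_annulus:
  assumes "0 < r"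
  shows "connected (annulus r R)"
proof -
  have "annulus r R = (\<lambda>(t, u). t *\<^sub>R u) ` ({r..R} \<times> sphere 0 1)"
  proof (intro equalityI subsetI)
    fix z assume z: "z \<in> annulus r R"
    then have "z \<noteq> 0" using assms by (auto simp: annulus_def)
    then have "z = norm z *\<^sub>R sgn z" "norm (sgn z) = 1"
      by (simp_all add: sgn_div_norm)
    then show "z \<in> (\<lambda>(t, u). t *\<^sub>R u) ` ({r..R} \<times> sphere 0 1)"
      using z by (intro image_eqI[of _ _ "(norm z, sgn z)"]) (auto simp: annulus_def)
  qed (use assms in \<open>auto simp: annulus_def\<close>)
  moreover have "connected ({r..R} \<times> sphere (0::complex) 1)"
    by (intro connected_Times connected_sphere) auto
  ultimately show ?thesis
    by (simp add: connected_continuous_image continuous_intros split_def)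
qed

lemma ring_annulus:
  assumes "0 < r" "r < R"
  shows "ring_continuum r R (annulus r R)"
proof -
  have "separated_by r R (annulus r R) (ball 0 r) (- cball 0 R)"
    unfolding separated_by_def using assms by (auto simp: annulus_def)
  then show ?thesis using compact_annulus connected_annulus[OF assms(1)] unfolding ring_continuum_def by blast
qed

text \<open>On the real axis, \<open>C1\<close> has a point to the left of the ring \<open>C2\<close> and a point in its hole.\<close>

lemma rings_cross:
  assumes C1: "ring_continuum r R C1" and C2: "ring_continuum r R C2"
    and r: "0 < r" "r < R"
    and sub1: "C1 \<subseteq> {z. a < norm z \<and> norm z < b}"
    and sub2: "C2 \<subseteq> {z. a < norm (z - of_real e) \<and> norm (z - of_real e) < b}"
    and e: "0 < e" "e \<le> a" "b \<le> a + e"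
  shows "C1 \<inter> C2 \<noteq> {}"
proof
  assume dis: "C1 \<inter> C2 = {}"
  obtain U W where S1: "open U" "open W" "U \<inter> W = {}" "U \<union> W = - C1"
      "ball 0 r \<subseteq> U" "{z. R < norm z} \<subseteq> W"
    using C1 unfolding ring_continuum_def separated_by_def by blast
  obtain U2 W2 where S2: "open U2" "open W2" "U2 \<inter> W2 = {}" "U2 \<union> W2 = - C2"
      "ball 0 r \<subseteq> U2" "{z. R < norm z} \<subseteq> W2"
    using C2 unfolding ring_continuum_def separated_by_def by blast
  have side: "T \<subseteq> U2 \<or> T \<subseteq> W2" if "connected T" "T \<inter> C2 = {}" for T
  proof -
    have "T \<subseteq> U2 \<union> W2" using that(2) S2(4) by blast
    then show ?thesis using connectedD[OF that(1) S2(1,2)] S2(3) by blast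
  qed
  have sideU: "T \<subseteq> U2" if "connected T" "T \<inter> C2 = {}" "x \<in> T" "x \<in> U2" for T x
    using side[OF that(1,2)] that(3,4) S2(3) by blast
  have sideW: "T \<subseteq> W2" if "connected T" "T \<inter> C2 = {}" "x \<in> T" "x \<in> W2" for T x
    using side[OF that(1,2)] that(3,4) S2(3) by blast
  \<comment> \<open>The segment from 0 to the point of norm \<open>R + 1\<close> runs from
    \<open>U\<close> to \<open>W\<close>, so it must hit \<open>C1\<close>; s is the sign of the
    half-axis.\<close>
  have axis: "\<exists>t>0. of_real (s * t) \<in> C1" if s: "\<bar>s\<bar> = 1" for s :: real
  proof -
    define L where "L = (\<lambda>t. complex_of_real (s * t)) ` {0..R+1}"
    have "connected L" unfolding L_def by (intro connected_continuous_image continuous_intros) auto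
    moreover have "complex_of_real (s * 0) \<in> L" unfolding L_def using r by (intro imageI) auto
    moreover have "complex_of_real (s * (R + 1)) \<in> L" unfolding L_def using r by (intro imageI) auto
    moreover have "complex_of_real (s * 0) \<in> U" using S1(5) r by auto
    moreover have "norm (complex_of_real (s * (R + 1))) = R + 1"
      unfolding norm_of_real using r s by (simp add: abs_mult)
    then have "complex_of_real (s * (R + 1)) \<in> W" using S1(6) by auto
    ultimately have "U \<inter> W \<inter> L \<noteq> {} \<or> \<not> L \<subseteq> U \<union> W"
      using connectedD[of L U W] S1(1,2) by auto
    then obtain y where y: "y \<in> L" "y \<notin> U \<union> W" using S1(3) by auto
    then obtain t where t: "t \<ge> 0" "y = complex_of_real (s * t)" unfolding L_def by auto
    have "y \<in> C1" using y(2) S1(4) by auto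
    moreover have "t \<noteq> 0"
    proof
      assume "t = 0"
      then have "y \<in> ball 0 r" using t r by simp
      then show False using y(2) S1(5) by blast
    qed
    ultimately show ?thesis using t by (intro exI[of _ t]) simp
  qed
  obtain t where t: "t > 0" "complex_of_real t \<in> C1" using axis[of 1] by auto
  obtain u where u: "u > 0" "complex_of_real (- u) \<in> C1" using axis[of "-1"] by auto
  have tb: "a < t" "t < b" using sub1 t by auto
  have ub: "a < u" "u < b" using sub1 u by auto
  \<comment> \<open>This disc misses \<open>C2\<close> and contains 0 because
    \<open>e \<le> a\<close>; the point t lies in it because t <
    \<open>b \<le> a + e\<close>.\<close>
  have "cball (of_real e) a \<subseteq> U2"
  proof -
    have "cball (complex_of_real e) a \<inter> C2 = {}" using sub2 by (auto simp: dist_norm norm_minus_commute)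
    moreover have "0 \<in> cball (complex_of_real e) a" using e by simp
    moreover have "0 \<in> U2" using S2(5) r by auto
    ultimately show ?thesis by (intro sideU[of _ 0]) auto
  qed
  moreover have "complex_of_real t \<in> cball (of_real e) a"
  proof -
    have "norm (complex_of_real e - of_real t) = \<bar>e - t\<bar>" by (metis norm_of_real of_real_diff)
    then show ?thesis using tb e by (simp add: dist_norm)
  qed
  ultimately have 1: "complex_of_real t \<in> U2" by blast
  \<comment> \<open>This exterior misses \<open>C2\<close> and reaches infinity; the point -u lies
    in it because u + \<open>e\<close> > \<open>a + e \<ge> b\<close>. Thus \<open>C1\<close> has
    points on both sides of \<open>C2\<close>.\<close>
  have "- ball (of_real e) b \<subseteq> W2"
  proof -
    have "- ball (complex_of_real e) b \<inter> C2 = {}" using sub2 by (auto simp: dist_norm norm_minus_commute)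
    moreover have "connected (- ball (complex_of_real e) b)"
      by (rule connected_complement_bounded_convex) auto
    moreover have "norm (complex_of_real e - of_real (- (\<bar>b\<bar> + R + 1))) = e + \<bar>b\<bar> + R + 1"
      unfolding of_real_diff[symmetric] norm_of_real using e r by simp
    then have "complex_of_real (- (\<bar>b\<bar> + R + 1)) \<in> - ball (complex_of_real e) b"
      using e r by (simp add: dist_norm del: of_real_minus of_real_add)
    moreover have "norm (complex_of_real (- (\<bar>b\<bar> + R + 1))) = \<bar>b\<bar> + R + 1"
      unfolding norm_of_real using r by simp
    then have "complex_of_real (- (\<bar>b\<bar> + R + 1)) \<in> W2" using S2(6) by auto
    ultimately show ?thesis by (intro sideW)
  qed
  moreover have "complex_of_real (- u) \<in> - ball (of_real e) b"
  proof -
    have "norm (complex_of_real e - of_real (- u)) = \<bar>e + u\<bar>"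
      unfolding of_real_diff[symmetric] norm_of_real by simp
    then show ?thesis using ub e by (simp add: dist_norm del: of_real_minus)
  qed
  ultimately have 2: "complex_of_real (- u) \<in> W2" by blast
  have "connected C1" using C1 unfolding ring_continuum_def by blast
  from side[OF this dis] show False using 1 2 t u S2(3) by blast
qed

section \<open>Limit sets of systems of polynomials\<close>

text \<open>Some index works for infinitely many n by the pigeonhole principle, hence for all n
  since the sets decrease.\<close>

lemma INT_UN_vimage_decseq:
  assumes fin: "finite Q" and dec: "\<And>n. S (Suc n) \<subseteq> S n"
  shows "(\<Inter>n. \<Union>p\<in>Q. f p -` S n) = (\<Union>p\<in>Q. f p -` (\<Inter>n. S n))"
proof (intro equalityI subsetI)
  have mono: "S n \<subseteq> S m" if "m \<le> n" for m n
    using lift_Suc_antimono_le[of S, OF dec that] .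
  fix z assume "z \<in> (\<Inter>n. \<Union>p\<in>Q. f p -` S n)"
  then have "\<forall>n. \<exists>p. p \<in> Q \<and> f p z \<in> S n" by blast
  from choice[OF this] obtain c where c: "\<And>n. c n \<in> Q" "\<And>n. f (c n) z \<in> S n" by blast
  have "finite (c ` UNIV)" by (rule finite_subset[OF _ fin]) (use c(1) in auto)
  from pigeonhole_infinite[OF infinite_UNIV_nat this] obtain k where
    k: "infinite {n \<in> UNIV. c n = c k}" by blast
  have "f (c k) z \<in> S n" for n
  proof -
    obtain m where "m \<ge> n" "c m = c k"
      using k unfolding infinite_nat_iff_unbounded_le by auto
    then show ?thesis using c(2)[of m] mono[of n m] by auto
  qed
  then show "z \<in> (\<Union>p\<in>Q. f p -` (\<Inter>n. S n))" using c(1)[of k] by auto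
qed auto

lemma level_mono: "P \<subseteq> Q \<Longrightarrow> level P D n \<subseteq> level Q D n"
proof (induction n)
  case (Suc n)
  then show ?case by (auto 0 3)
qed simp

lemma limset_mono:
  assumes "P \<subseteq> Q"
  shows "limset P D \<subseteq> limset Q D"
proof -
  have "limset P D \<subseteq> level Q D n" for n
    using level_mono[OF assms, of D n] unfolding limset_def by blast
  then show ?thesis unfolding limset_def[of Q] by (rule INT_greatest)
qed

lemma level_singleton: "level {p} D n = (poly p ^^ n) -` D"
proof (induction n)
  case (Suc n)
  have "level {p} D (Suc n) = poly p -` (poly p ^^ n) -` D" using Suc by simp
  also have "\<dots> = (poly p ^^ Suc n) -` D" by (simp only: funpow_Suc_right vimage_comp)
  finally show ?case .
qed simp

text \<open>For a forward invariant \<open>S\<close> this is the set of points whose orbits are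
  eventually captured by \<open>S\<close>. The basins of the inner disc and of the exterior are the
  two sides of the Julia set of a single map.\<close>

definition basin :: "(complex \<Rightarrow> complex) \<Rightarrow> complex set \<Rightarrow> complex set" where
  "basin f S = (\<Union>n. (f ^^ n) -` S)"

lemma continuous_on_funpow: "continuous_on UNIV f \<Longrightarrow> continuous_on UNIV (f ^^ n)"
  for f :: "'a::topological_space \<Rightarrow> 'a"
proof (induction n)
  case (Suc n)
  have "continuous_on UNIV (f \<circ> (f ^^ n))"
    by (intro continuous_on_compose Suc.IH Suc.prems) (auto intro: continuous_on_subset[OF Suc.prems])
  then show ?case by simp
qed (simp add: id_def)

lemma funpow_invariant: "(\<And>z. z \<in> S \<Longrightarrow> f z \<in> S) \<Longrightarrow> z \<in> S \<Longrightarrow> (f ^^ n) z \<in> S"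
  by (induction n) auto

lemma basin_disjoint:
  assumes "\<And>z. z \<in> S \<Longrightarrow> f z \<in> S" "\<And>z. z \<in> T \<Longrightarrow> f z \<in> T" "S \<inter> T = {}"
  shows "basin f S \<inter> basin f T = {}"
proof -
  have False if m: "(f ^^ m) z \<in> S" and n: "(f ^^ n) z \<in> T" for m n z
  proof -
    have "(f ^^ (n + m)) z \<in> S" using funpow_invariant[OF assms(1) m, where n=n] by (simp add: funpow_add)
    moreover have "(f ^^ (m + n)) z \<in> T" using funpow_invariant[OF assms(2) n, where n=m] by (simp add: funpow_add)
    ultimately show False using assms(3) by (metis add.commute disjoint_iff)
  qed
  then show ?thesis unfolding basin_def by blast
qed

context expanding_system
begin

abbreviation "D \<equiv> annulus r R"

text \<open>Lets every result about the system apply to a single generator, whose limit set is its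
  own Julia set.\<close>

lemma subsystem: "Q \<subseteq> P \<Longrightarrow> Q \<noteq> {} \<Longrightarrow> expanding_system Q r R lam"
  using finite_subset[OF _ finite_P] r_pos r_less_R lam deg inner outer roots expanding
  by unfold_locales auto

lemma level_Suc_subset: "level P D (Suc n) \<subseteq> level P D n"
proof (induction n)
  case 0
  then show ?case using level_subset[of 1] by simp
next
  case (Suc n)
  show ?case unfolding level.simps(2)[of _ _ "Suc n"] level.simps(2)[of _ _ n]
    using Suc by (intro UN_mono vimage_mono) auto
qed

lemma closed_poly_vimage: "closed S \<Longrightarrow> closed (poly p -` S)" for p :: "complex poly"
  by (intro closed_vimage continuous_intros) auto

lemma compact_level: "compact (level P D n)"
proof -
  have "closed (level P D n)"
  proof (induction n)
    case (Suc n)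
    then show ?case using finite_P by (auto intro!: closed_UN closed_poly_vimage)
  qed (simp add: compact_imp_closed compact_annulus)
  then have "compact (D \<inter> level P D n)" by (intro compact_Int_closed compact_annulus)
  moreover have "D \<inter> level P D n = level P D n" using level_subset by blast
  ultimately show ?thesis by simp
qed

lemma level_antimono: "m \<le> n \<Longrightarrow> level P D n \<subseteq> level P D m"
  by (rule lift_Suc_antimono_le[of "level P D", OF level_Suc_subset])

lemma limset_eq: "limset P D = (\<Union>p\<in>P. poly p -` limset P D)"
proof -
  have "limset P D = (\<Inter>n. level P D (Suc n))"
    unfolding limset_def using level_Suc_subset by blast
  also have "\<dots> = (\<Inter>n. \<Union>p\<in>P. poly p -` level P D n)" by simp
  also have "\<dots> = (\<Union>p\<in>P. poly p -` limset P D)"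
    unfolding limset_def
    by (rule INT_UN_vimage_decseq[where S="level P D", OF finite_P level_Suc_subset])
  finally show ?thesis .
qed

lemma vimage_limset_subset: "p \<in> P \<Longrightarrow> poly p -` limset P D \<subseteq> limset P D"
  using limset_eq by blast

lemma compact_limset: "compact (limset P D)"
  unfolding limset_def using compact_level by (intro compact_Inter) auto

lemma ring_poly_vimage:
  assumes "p \<in> P" "ring_continuum r R C"
  shows "ring_continuum r R (poly p -` C)"
proof (rule ring_vimage[OF assms(2) r_pos r_less_R])
  show "1 \<le> degree p" using deg[OF assms(1)] by simp
qed (use inner outer roots assms(1) in auto)

lemma ring_funpow_vimage: "p \<in> P \<Longrightarrow> ring_continuum r R C \<Longrightarrow> ring_continuum r R ((poly p ^^ n) -` C)"
proof (induction n)
  case (Suc n)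
  have eq: "(poly p ^^ Suc n) -` C = poly p -` (poly p ^^ n) -` C"
    by (simp only: funpow_Suc_right vimage_comp)
  show ?case unfolding eq by (rule ring_poly_vimage[OF Suc.prems(1) Suc.IH[OF Suc.prems]])
qed simp

text \<open>An orbit that leaves the annulus does so inwards or outwards, and by invariance of both
  regions it cannot do both.\<close>

lemma separated_by_limset_singleton:
  assumes p: "p \<in> P"
  shows "separated_by r R (limset {p} D) (basin (poly p) (ball 0 r)) (basin (poly p) {z. R < norm z})"
  unfolding separated_by_def
proof (intro conjI)
  have "continuous_on UNIV (poly p ^^ n)" for n
    by (intro continuous_on_funpow continuous_intros)
  then have opn: "open (basin (poly p) S)" if "open S" for S
    unfolding basin_def using that by (intro open_UN ballI open_vimage)
  show "open (basin (poly p) (ball 0 r))" by (rule opn) simp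
  have "{z::complex. R < norm z} = - cball 0 R" by auto
  then show "open (basin (poly p) {z. R < norm z})" by (intro opn) (simp add: open_Compl)
  show "basin (poly p) (ball 0 r) \<inter> basin (poly p) {z. R < norm z} = {}"
    by (rule basin_disjoint) (use inner[OF p] outer[OF p] r_less_R in \<open>auto simp: less_imp_le\<close>)
  show "basin (poly p) (ball 0 r) \<union> basin (poly p) {z. R < norm z} = - limset {p} D"
  proof (rule set_eqI)
    show "z \<in> basin (poly p) (ball 0 r) \<union> basin (poly p) {z. R < norm z} \<longleftrightarrow> z \<in> - limset {p} D" for z
      unfolding basin_def limset_def level_singleton by (auto simp: annulus_def not_le)
  qed
  have sub: "S \<subseteq> basin (poly p) S" for S
  proof
    fix z assume "z \<in> S"
    then show "z \<in> basin (poly p) S" unfolding basin_def by (intro UN_I[of 0]) auto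
  qed
  show "ball 0 r \<subseteq> basin (poly p) (ball 0 r)" by (rule sub)
  show "{z. R < norm z} \<subseteq> basin (poly p) {z. R < norm z}" by (rule sub)
qed

text \<open>For one map the levels are iterated preimages of the annulus, hence nested rings; their
  intersection inherits connectedness, while the basins supply the separation.\<close>

lemma ring_limset_singleton:
  assumes p: "p \<in> P"
  shows "ring_continuum r R (limset {p} D)"
proof -
  interpret S: expanding_system "{p}" r R lam by (rule subsystem) (use p in auto)
  have "ring_continuum r R (level {p} D n)" for n
    unfolding level_singleton by (intro ring_funpow_vimage p ring_annulus r_pos r_less_R)
  then have "connected (level {p} D n)" for n unfolding ring_continuum_def by blast
  then have "connected (limset {p} D)"
    unfolding limset_def by (intro connected_nest S.compact_level S.level_antimono) auto
  then show ?thesis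
    using S.compact_limset S.limset_subset separated_by_limset_singleton[OF p] unfolding ring_continuum_def by blast
qed

end

text \<open>The numbers \<open>a\<close> and \<open>b\<close> bound the preimages of the annulus
  under \<open>p1\<close>, about 0, and \<open>p2\<close>, about \<open>e\<close>. The conditions
  \<open>e \<le> a\<close> and \<open>b \<le> a + e\<close> make rings in them cross;
  \<open>b + e \<le> s\<close> puts both into a disc that \<open>p3\<close> sends into the inner
  disc.\<close>

locale three_maps = expanding_system "{p1, p2, p3}" r R lam
  for p1 p2 p3 :: "complex poly" and r R lam :: real +
  fixes a b e s :: real
  assumes radii: "0 < e" "e \<le> a" "b \<le> a + e" "b + e \<le> s"
    and p1_inner: "norm z \<le> a \<Longrightarrow> norm (poly p1 z) < r"
    and p1_outer: "b \<le> norm z \<Longrightarrow> R < norm (poly p1 z)"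
    and p2_inner: "norm (z - of_real e) \<le> a \<Longrightarrow> norm (poly p2 z) < r"
    and p2_outer: "b \<le> norm (z - of_real e) \<Longrightarrow> R < norm (poly p2 z)"
    and p3_inner: "norm z \<le> s \<Longrightarrow> norm (poly p3 z) < r"
begin

abbreviation "L \<equiv> level {p1, p2, p3} D"
abbreviation "X \<equiv> limset {p1, p2, p3} D"

definition "A = poly p1 -` X \<union> poly p2 -` X"
definition "J3 = limset {p3} D"
definition "K n = (poly p3 ^^ n) -` A"

lemma p1_vimage: "poly p1 -` D \<subseteq> {z. a < norm z \<and> norm z < b}"
  using p1_inner p1_outer by (force simp: annulus_def not_le[symmetric])

lemma p2_vimage: "poly p2 -` D \<subseteq> {z. a < norm (z - of_real e) \<and> norm (z - of_real e) < b}"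
  using p2_inner p2_outer by (force simp: annulus_def not_le[symmetric])

lemma p3_vimage: "poly p3 -` D \<subseteq> {z. s < norm z}"
  using p3_inner by (force simp: annulus_def not_le[symmetric])

lemma p12_vimage: "poly p1 -` D \<union> poly p2 -` D \<subseteq> ball 0 s"
proof -
  have "norm z < s" if "norm (z - of_real e) < b" for z :: complex
    using norm_triangle_ineq[of "z - of_real e" "of_real e"] that radii by simp
  then show ?thesis using p1_vimage p2_vimage radii by fastforce
qed

text \<open>Each preimage under \<open>p1\<close> of a member crosses each preimage under
  \<open>p2\<close> of a member, so all of them fuse even if the members themselves are
  disjoint.\<close>

lemma ring_p12_vimage:
  assumes ne: "\<R> \<noteq> {}" and rings: "\<And>C. C \<in> \<R> \<Longrightarrow> ring_continuum r R C" and comp: "compact (\<Union>\<R>)"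
  shows "ring_continuum r R (poly p1 -` (\<Union>\<R>) \<union> poly p2 -` (\<Union>\<R>))"
proof -
  have r1: "ring_continuum r R (poly p1 -` C)" and r2: "ring_continuum r R (poly p2 -` C)" if "C \<in> \<R>" for C
    using ring_poly_vimage rings[OF that] by auto
  have sub: "C \<subseteq> D" if "C \<in> \<R>" for C using rings[OF that] unfolding ring_continuum_def by blast
  have meet: "poly p1 -` C \<inter> poly p2 -` C' \<noteq> {}" if "C \<in> \<R>" "C' \<in> \<R>" for C C'
  proof (rule rings_cross[OF r1[OF that(1)] r2[OF that(2)] r_pos r_less_R])
    show "poly p1 -` C \<subseteq> {z. a < norm z \<and> norm z < b}" using p1_vimage sub[OF that(1)] by blast
    show "poly p2 -` C' \<subseteq> {z. a < norm (z - of_real e) \<and> norm (z - of_real e) < b}"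
      using p2_vimage sub[OF that(2)] by blast
  qed (use radii in auto)
  have con: "connected (poly p1 -` C)" "connected (poly p2 -` C)" if "C \<in> \<R>" for C
    using r1 r2 that unfolding ring_continuum_def by blast+
  obtain C0 where C0: "C0 \<in> \<R>" using ne by blast
  \<comment> \<open>One preimage \<open>poly p2 -\<close> of \<open>C0\<close> serves as the hub
    joining all preimages under \<open>p1\<close>; the other preimages under \<open>p2\<close> are
    then attached to \<open>T\<close>.\<close>
  define T where "T = (\<Union>C\<in>\<R>. poly p1 -` C \<union> poly p2 -` C0)"
  have "connected T" unfolding T_def
  proof (rule connected_Union)
    show "connected S" if "S \<in> (\<lambda>C. poly p1 -` C \<union> poly p2 -` C0) ` \<R>" for S
      using that meet C0 con by (auto intro!: connected_Un)
    obtain y where "y \<in> poly p2 -` C0" using meet[OF C0 C0] by blast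
    then show "\<Inter> ((\<lambda>C. poly p1 -` C \<union> poly p2 -` C0) ` \<R>) \<noteq> {}" by blast
  qed
  have "connected (\<Union>C\<in>\<R>. poly p2 -` C \<union> T)"
  proof (rule connected_Union)
    show "connected S" if "S \<in> (\<lambda>C. poly p2 -` C \<union> T) ` \<R>" for S
    proof -
      obtain C where C: "C \<in> \<R>" "S = poly p2 -` C \<union> T" using \<open>S \<in> _\<close> by blast
      have "poly p1 -` C \<subseteq> T" unfolding T_def using C(1) by blast
      then have "poly p2 -` C \<inter> T \<noteq> {}" using meet[OF C(1) C(1)] by blast
      then show ?thesis unfolding C(2) using con(2)[OF C(1)] \<open>connected T\<close> by (intro connected_Un)
    qed
    obtain y where "y \<in> poly p2 -` C0" using meet[OF C0 C0] by blast
    then have "y \<in> T" unfolding T_def using C0 by blast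
    then show "\<Inter> ((\<lambda>C. poly p2 -` C \<union> T) ` \<R>) \<noteq> {}" by blast
  qed
  moreover have eq: "(\<Union>C\<in>\<R>. poly p2 -` C \<union> T) = poly p1 -` (\<Union>\<R>) \<union> poly p2 -` (\<Union>\<R>)"
    unfolding T_def using C0 by blast
  ultimately have "connected (poly p1 -` (\<Union>\<R>) \<union> poly p2 -` (\<Union>\<R>))" by simp
  moreover have D: "poly p1 -` (\<Union>\<R>) \<union> poly p2 -` (\<Union>\<R>) \<subseteq> D"
    using sub vimage_annulus_subset[of p1] vimage_annulus_subset[of p2] by blast
  moreover have "compact (poly p1 -` (\<Union>\<R>) \<union> poly p2 -` (\<Union>\<R>))"
  proof -
    have "closed (poly p1 -` (\<Union>\<R>) \<union> poly p2 -` (\<Union>\<R>))"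
      using compact_imp_closed[OF comp] by (intro closed_Un closed_poly_vimage)
    then have "compact (D \<inter> (poly p1 -` (\<Union>\<R>) \<union> poly p2 -` (\<Union>\<R>)))"
      by (intro compact_Int_closed compact_annulus)
    then show ?thesis using D by (simp add: Int_absorb1)
  qed
  moreover have "poly p1 -` C0 \<subseteq> poly p1 -` (\<Union>\<R>) \<union> poly p2 -` (\<Union>\<R>)" using C0 by blast
  ultimately show ?thesis by (intro ring_mono[OF r1[OF C0]])
qed

text \<open>Passing to the next level fuses the preimages under \<open>p1\<close> and
  \<open>p2\<close> into one new ring, whereas \<open>p3\<close> pulls every ring back to a ring of
  its own.\<close>

lemma level_rings: "\<exists>\<R>. \<R> \<noteq> {} \<and> (\<forall>C\<in>\<R>. ring_continuum r R C) \<and> L n = \<Union>\<R>"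
proof (induction n)
  case 0
  show ?case using ring_annulus[OF r_pos r_less_R] by (intro exI[of _ "{D}"]) simp
next
  case (Suc n)
  obtain \<R> where R: "\<R> \<noteq> {}" "\<forall>C\<in>\<R>. ring_continuum r R C" "L n = \<Union>\<R>"
    using Suc.IH by (elim exE conjE) (rule that)
  define B where "B = poly p1 -` (\<Union>\<R>) \<union> poly p2 -` (\<Union>\<R>)"
  have "ring_continuum r R B" unfolding B_def
    by (rule ring_p12_vimage[OF R(1) R(2)[rule_format]]) (use compact_level[of n] R(3) in auto)
  moreover have "ring_continuum r R (poly p3 -` C)" if "C \<in> \<R>" for C
    using ring_poly_vimage R(2) that by simp
  moreover have "L (Suc n) = \<Union> (insert B ((\<lambda>C. poly p3 -` C) ` \<R>))"
    unfolding B_def by (simp add: R(3)) blast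
  ultimately show ?case by (intro exI[of _ "insert B ((\<lambda>C. poly p3 -` C) ` \<R>)"]) auto
qed

lemma A_subset: "A \<subseteq> X" "A \<subseteq> ball 0 s" "A \<subseteq> D"
proof -
  show "A \<subseteq> X" unfolding A_def using vimage_limset_subset by blast
  then show "A \<subseteq> D" using limset_subset by blast
  show "A \<subseteq> ball 0 s" unfolding A_def using p12_vimage limset_subset by blast
qed

text \<open>The Julia set of \<open>p\<close> is its own preimage under \<open>p\<close> and lies in
  \<open>X\<close>. This gives the inclusion of J(h1) and J(h2) in the minimal component.\<close>

lemma limset_singleton_subset_A:
  assumes "p \<in> {p1, p2}"
  shows "limset {p} D \<subseteq> A"
proof -
  interpret S: expanding_system "{p}" r R lam by (rule subsystem) (use assms in auto)
  have "limset {p} D \<subseteq> poly p -` limset {p} D" using S.limset_eq by simp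
  also have "\<dots> \<subseteq> poly p -` X" using assms by (intro vimage_mono limset_mono) auto
  also have "\<dots> \<subseteq> A" using assms unfolding A_def by auto
  finally show ?thesis .
qed

lemma ring_A: "ring_continuum r R A"
proof -
  have "A = (\<Union>p\<in>{p1, p2}. poly p -` (\<Inter>n. L n))" unfolding A_def limset_def by simp
  also have "\<dots> = (\<Inter>n. \<Union>p\<in>{p1, p2}. poly p -` L n)"
    by (rule INT_UN_vimage_decseq[symmetric]) (use level_Suc_subset in auto)
  finally have A: "A = (\<Inter>n. poly p1 -` L n \<union> poly p2 -` L n)" by simp
  have ring: "ring_continuum r R (poly p1 -` L n \<union> poly p2 -` L n)" for n
  proof -
    obtain \<R> where R: "\<R> \<noteq> {}" "\<forall>C\<in>\<R>. ring_continuum r R C" "L n = \<Union>\<R>"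
      using level_rings[of n] by (elim exE conjE) (rule that)
    show ?thesis unfolding R(3)
      by (rule ring_p12_vimage[OF R(1) R(2)[rule_format]]) (use compact_level[of n] R(3) in auto)
  qed
  have "connected A" unfolding A
  proof (rule connected_nest)
    show "compact (poly p1 -` L n \<union> poly p2 -` L n)" "connected (poly p1 -` L n \<union> poly p2 -` L n)" for n
      using ring unfolding ring_continuum_def by blast+
    show "poly p1 -` L n \<union> poly p2 -` L n \<subseteq> poly p1 -` L m \<union> poly p2 -` L m" if "m \<le> n" for m n
      using level_antimono[OF that] by blast
  qed
  moreover have "closed A" unfolding A_def
    using compact_imp_closed[OF compact_limset] by (intro closed_Un closed_poly_vimage)
  then have "compact (D \<inter> A)" by (intro compact_Int_closed compact_annulus)
  then have "compact A" using A_subset(3) by (simp add: Int_absorb1)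
  \<comment> \<open>Connectedness alone does not make \<open>A\<close> a ring; the separation is
    inherited from this smaller ring inside it.\<close>
  moreover have "limset {p1} D \<subseteq> A" by (rule limset_singleton_subset_A) simp
  ultimately show ?thesis
    using A_subset(3) by (intro ring_mono[OF ring_limset_singleton[of p1]]) auto
qed

end

section \<open>Components of the limit set\<close>

text \<open>The complementary component containing \<open>C\<close> cannot pass from
  \<open>U\<close> to \<open>W\<close>, and everything beyond radius \<open>R\<close> is in
  \<open>W\<close>; so this component is bounded.\<close>

lemma surr_le_if_separated:
  assumes S: "separated_by r R K U W" and C: "connected C" "C \<noteq> {}" "C \<subseteq> U"
  shows "surr_le C K"
proof -
  have S': "open U" "open W" "U \<inter> W = {}" "U \<union> W = - K" "{z. R < norm z} \<subseteq> W"
    using S unfolding separated_by_def by auto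
  obtain x where x: "x \<in> C" using C(2) by blast
  define T where "T = connected_component_set (- K) x"
  have CK: "C \<subseteq> - K" using C(3) S'(4) by blast
  have CT: "C \<subseteq> T" unfolding T_def by (rule connected_component_maximal[OF x C(1) CK])
  have T: "connected T" "T \<subseteq> - K" unfolding T_def
    by (auto simp: connected_component_subset)
  have "T \<in> components (- K)" unfolding T_def using x CK by (intro componentsI) auto
  moreover have "T \<subseteq> U"
  proof -
    have "U \<inter> W \<inter> T = {}" "T \<subseteq> U \<union> W" using S'(3,4) T(2) by auto
    then have "U \<inter> T = {} \<or> W \<inter> T = {}" using connectedD[OF T(1) S'(1,2)] by simp
    moreover have "x \<in> U \<inter> T" using x C(3) CT by blast
    ultimately show ?thesis using \<open>T \<subseteq> U \<union> W\<close> by blast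
  qed
  then have "T \<subseteq> cball 0 R" using S'(3,5) by (force simp: not_less[symmetric])
  then have "bounded T" by (rule bounded_subset[OF bounded_cball])
  ultimately show ?thesis unfolding surr_le_def using CT by (auto simp: Compl_eq_Diff_UNIV)
qed

text \<open>The radial ray from z to infinity avoids \<open>K2\<close>, because no point of
  \<open>K2\<close> has larger norm than z. A complementary component containing z is therefore
  unbounded.\<close>

lemma not_surr_by_bounded:
  fixes K1 K2 :: "complex set"
  assumes K2: "K2 \<subseteq> cball 0 (norm z)" and z: "z \<in> K1"
    and B: "B \<in> components (UNIV - K2)" "bounded B" "K1 \<subseteq> B"
  shows False
proof (cases "z = 0")
  case False
  define ray where "ray = (\<lambda>t. t *\<^sub>R z) ` {1..}"
  have "ray \<subseteq> UNIV - K2"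
  proof -
    have "t *\<^sub>R z \<notin> K2" if "t \<ge> 1" for t
    proof (cases "t = 1")
      case True
      then show ?thesis using z B in_components_subset by auto
    next
      case False
      then have "1 * norm z < t * norm z" using \<open>z \<noteq> 0\<close> that by (intro mult_strict_right_mono) auto
      then have "t *\<^sub>R z \<notin> cball 0 (norm z)" using that by simp
      then show ?thesis using K2 by blast
    qed
    then show ?thesis unfolding ray_def by blast
  qed
  moreover have "connected ray" unfolding ray_def
    by (intro connected_continuous_image continuous_intros) auto
  moreover have "z \<in> B \<inter> ray" using z B(3) unfolding ray_def by (auto intro!: image_eqI[of _ _ 1])
  ultimately have "ray \<subseteq> B" using components_maximal[OF B(1)] by blast
  with B(2) have "bounded ray" by (rule bounded_subset)
  then obtain M where M: "\<And>y. y \<in> ray \<Longrightarrow> norm y \<le> M" unfolding bounded_iff by auto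
  define t where "t = \<bar>M\<bar> / norm z + 1"
  have "t *\<^sub>R z \<in> ray" unfolding ray_def t_def by (intro imageI) simp
  then have "\<bar>t\<bar> * norm z \<le> M" using M[of "t *\<^sub>R z"] by simp
  moreover have "\<bar>t\<bar> * norm z = \<bar>M\<bar> + norm z" using False unfolding t_def by (simp add: field_simps)
  moreover have "norm z > 0" using False by simp
  ultimately show False by linarith
next
  case True
  \<comment> \<open>At the origin the ray degenerates, but then \<open>K2\<close> is empty and its
    complement is the whole plane.\<close>
  then have "K2 \<subseteq> {0}" using K2 by auto
  moreover have "0 \<notin> K2" using z True B in_components_subset by auto
  ultimately have "K2 = {}" by auto
  then have "B = UNIV" using B(1) by (simp add: components_UNIV)
  then show False using B(2) by (simp add: not_bounded_UNIV)
qed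

text \<open>A point of maximal norm in the union lies in one of the two sets, and that set cannot be
  enclosed by the other. This gives the uniqueness behind \<open>Jmin\<close> and
  \<open>Jmax\<close>.\<close>

lemma surr_le_antisym:
  assumes "surr_le K1 K2" "surr_le K2 K1" "compact K1" "compact K2" "K1 \<noteq> {}" "K2 \<noteq> {}"
  shows "K1 = K2"
proof (rule ccontr)
  assume ne: "K1 \<noteq> K2"
  have "compact (K1 \<union> K2)" "K1 \<union> K2 \<noteq> {}" using assms by auto
  moreover have "continuous_on (K1 \<union> K2) norm" by (intro continuous_intros)
  ultimately obtain z where z: "z \<in> K1 \<union> K2" "\<And>y. y \<in> K1 \<union> K2 \<Longrightarrow> norm y \<le> norm z"
    using continuous_attains_sup by metis
  have "K1 \<subseteq> cball 0 (norm z)" "K2 \<subseteq> cball 0 (norm z)" using z(2) by auto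
  then show False
    using not_surr_by_bounded z(1) assms(1,2) ne unfolding surr_le_def by (metis UnE)
qed

text \<open>The criterion does not ask the members to be relatively open. This is essential for
  \<open>J3\<close>, at which the components \<open>K n\<close> accumulate.\<close>

lemma components_eqI:
  assumes cov: "S = \<Union>\<C>" and con: "\<And>C. C \<in> \<C> \<Longrightarrow> connected C" and ne: "\<And>C. C \<in> \<C> \<Longrightarrow> C \<noteq> {}"
    and max: "\<And>C T. C \<in> \<C> \<Longrightarrow> connected T \<Longrightarrow> T \<subseteq> S \<Longrightarrow> T \<inter> C \<noteq> {} \<Longrightarrow> T \<subseteq> C"
  shows "components S = \<C>"
proof (intro equalityI subsetI)
  fix C assume C: "C \<in> \<C>"
  have "d = C" if "d \<noteq> {}" "C \<subseteq> d" "d \<subseteq> S" "connected d" for d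
  proof
    have "d \<inter> C \<noteq> {}" using that(2) ne[OF C] by blast
    then show "d \<subseteq> C" by (rule max[OF C that(4,3)])
  qed (rule that(2))
  then show "C \<in> components S"
    unfolding in_components_maximal using C con[OF C] ne[OF C] cov by blast
next
  fix T assume T: "T \<in> components S"
  then obtain x where x: "x \<in> T" using in_components_nonempty by blast
  have TS: "T \<subseteq> S" using T by (rule in_components_subset)
  then obtain C where C: "C \<in> \<C>" "x \<in> C" using x cov by blast
  have "T \<subseteq> C" using max[OF C(1) in_components_connected[OF T] TS] x C(2) by blast
  moreover have "C \<subseteq> T"
  proof (rule components_maximal[OF T con[OF C(1)]])
    show "C \<subseteq> S" using C(1) cov by blast
    show "T \<inter> C \<noteq> {}" using x C(2) by blast
  qed
  ultimately have "T = C" by (rule equalityI)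
  then show "T \<in> \<C>" using C(1) by simp
qed

context three_maps
begin

lemma K_0: "K 0 = A"
  by (simp add: K_def)

lemma K_Suc: "K (Suc n) = poly p3 -` K n"
  unfolding K_def by (simp only: funpow_Suc_right vimage_comp)

lemma ring_K: "ring_continuum r R (K n)"
  unfolding K_def by (rule ring_funpow_vimage[OF _ ring_A]) simp

lemma ring_J3: "ring_continuum r R J3"
  unfolding J3_def by (rule ring_limset_singleton) simp

lemma X_eq: "X = A \<union> poly p3 -` X"
  unfolding A_def by (subst limset_eq) auto

text \<open>\<open>A\<close> lies in \<open>ball 0 s\<close>, which \<open>p3\<close> sends into the
  inner disc, away from \<open>X\<close>. Hence the decomposition \<open>X_eq\<close> is
  disjoint.\<close>

lemma A_disjoint: "z \<in> A \<Longrightarrow> poly p3 z \<notin> X"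
proof
  assume "z \<in> A" "poly p3 z \<in> X"
  then have "poly p3 z \<in> D" "norm z < s" using limset_subset A_subset(2) by auto
  then show False using p3_vimage by auto
qed

lemma J3_subset: "J3 \<subseteq> X"
  unfolding J3_def by (rule limset_mono) simp

lemma J3_iff: "z \<in> J3 \<longleftrightarrow> (\<forall>n. (poly p3 ^^ n) z \<in> D)"
  unfolding J3_def limset_def level_singleton by simp

lemma poly_p3_J3: "z \<in> J3 \<longleftrightarrow> poly p3 z \<in> J3"
proof -
  interpret S: expanding_system "{p3}" r R lam by (rule subsystem) auto
  show ?thesis unfolding J3_def by (subst S.limset_eq) simp
qed

lemma K_subset: "K n \<subseteq> X"
proof (induction n)
  case 0
  then show ?case using A_subset by (simp add: K_0)
next
  case (Suc n)
  then show ?case using X_eq unfolding K_Suc by blast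
qed

text \<open>A point of \<open>X\<close> whose orbit under \<open>p3\<close> never hits
  \<open>A\<close> keeps its orbit in \<open>X\<close> by \<open>X_eq\<close>, hence in the annulus
  forever.\<close>

lemma X_cover: "X = (\<Union>n. K n) \<union> J3"
proof (intro equalityI subsetI)
  fix z assume z: "z \<in> X"
  show "z \<in> (\<Union>n. K n) \<union> J3"
  proof (cases "\<exists>n. (poly p3 ^^ n) z \<in> A")
    case False
    have "(poly p3 ^^ n) z \<in> X" for n
    proof (induction n)
      case (Suc n)
      then show ?case using False X_eq by auto
    qed (simp add: z)
    then have "z \<in> J3" unfolding J3_iff using limset_subset by blast
    then show ?thesis by blast
  qed (auto simp: K_def)
qed (use K_subset J3_subset in blast)

text \<open>Unrolling \<open>X_eq\<close> replaces the infinitely many later \<open>K k\<close> and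
  \<open>J3\<close> by one closed tail, so only finitely many closed sets have to be separated from
  \<open>K n\<close>.\<close>

lemma X_split: "X = (\<Union>k\<le>n. K k) \<union> (poly p3 ^^ Suc n) -` X"
proof (induction n)
  case 0
  then show ?case using X_eq by (simp add: K_0)
next
  case (Suc n)
  have "(poly p3 ^^ Suc n) -` X = (poly p3 ^^ Suc n) -` A \<union> (poly p3 ^^ Suc n) -` poly p3 -` X"
    using X_eq by blast
  also have "(poly p3 ^^ Suc n) -` poly p3 -` X = (poly p3 ^^ Suc (Suc n)) -` X"
    by (simp only: funpow.simps(2)[of "Suc n"] vimage_comp)
  finally have "(poly p3 ^^ Suc n) -` X = K (Suc n) \<union> (poly p3 ^^ Suc (Suc n)) -` X"
    unfolding K_def .
  then have "(\<Union>k\<le>Suc n. K k) \<union> (poly p3 ^^ Suc (Suc n)) -` X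
      = (\<Union>k\<le>n. K k) \<union> (poly p3 ^^ Suc n) -` X"
    unfolding atMost_Suc UN_insert by (simp only: Un_ac)
  then show ?case using Suc by (simp only:)
qed

lemma funpow_K: "z \<in> K (m + n) \<longleftrightarrow> (poly p3 ^^ m) z \<in> K n"
  unfolding K_def by (simp add: funpow_add[of n m] add.commute[of m n])

text \<open>After n steps a point of \<open>K n\<close> is in \<open>A\<close>, and one more
  application of \<open>p3\<close> takes it out of \<open>X\<close>.\<close>

lemma K_tail_disjoint: "K n \<inter> (poly p3 ^^ Suc n) -` X = {}"
  using A_disjoint unfolding K_def by auto

lemma K_disjoint:
  assumes "m < n"
  shows "K m \<inter> K n = {}"
proof -
  obtain k where n: "n = Suc m + k" using less_iff_Suc_add assms by (metis add_Suc)
  have "K n \<subseteq> (poly p3 ^^ Suc m) -` X"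
    using funpow_K[of _ "Suc m" k] K_subset unfolding n by blast
  then show ?thesis using K_tail_disjoint[of m] by blast
qed

lemma J3_K_disjoint: "J3 \<inter> K n = {}"
proof -
  have "(poly p3 ^^ k) z \<in> J3" if "z \<in> J3" for z k
    by (induction k) (use that poly_p3_J3 in auto)
  then have "J3 \<subseteq> (poly p3 ^^ Suc n) -` X" using J3_subset by blast
  then show ?thesis using K_tail_disjoint[of n] by blast
qed

lemma compact_K: "compact (K n)" "connected (K n)" "K n \<noteq> {}"
  using ring_K ring_nonempty[OF _ r_pos] unfolding ring_continuum_def by blast+

text \<open>\<open>K n\<close> and the rest \<open>E\<close> of \<open>X\<close> are disjoint closed
  sets, because \<open>E\<close> consists of finitely many \<open>K k\<close> and the closed
  tail.\<close>

lemma connected_subset_K: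
  assumes T: "connected T" "T \<subseteq> X" "T \<inter> K n \<noteq> {}"
  shows "T \<subseteq> K n"
proof -
  define E where "E = (\<Union>k<n. K k) \<union> (poly p3 ^^ Suc n) -` X"
  have "{..n} = insert n {..<n}" by auto
  then have X: "X = K n \<union> E" using X_split[of n] unfolding E_def by auto
  have dis: "K n \<inter> E = {}"
    using K_tail_disjoint[of n] K_disjoint[of _ n] unfolding E_def by blast
  have "closed ((poly p3 ^^ Suc n) -` X)"
    by (intro closed_vimage continuous_on_funpow continuous_intros compact_imp_closed compact_limset)
  moreover have K: "closed (K k)" for k using compact_K(1) by (rule compact_imp_closed)
  then have "closed (\<Union>k<n. K k)" by (intro closed_UN) auto
  ultimately have "closed E" unfolding E_def by (rule closed_Un[rotated])
  moreover have cov: "T \<subseteq> K n \<union> E" using T(2) X by simp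
  moreover have "K n \<inter> E \<inter> T = {}" using dis by simp
  ultimately have "K n \<inter> T = {} \<or> E \<inter> T = {}" using connected_closedD[OF T(1) _ _ K] by blast
  then have "E \<inter> T = {}" using T(3) by (simp add: Int_commute)
  then show ?thesis using cov by blast
qed

text \<open>By elimination: if \<open>T\<close> met some \<open>K n\<close>, it would be contained
  in it and miss \<open>J3\<close>.\<close>

lemma connected_subset_J3:
  assumes T: "connected T" "T \<subseteq> X" "T \<inter> J3 \<noteq> {}"
  shows "T \<subseteq> J3"
proof -
  have "T \<inter> K n = {}" for n
    using connected_subset_K[OF T(1,2), of n] T(3) J3_K_disjoint[of n] by blast
  then show ?thesis using T(2) X_cover by blast
qed

text \<open>For positive n the ring \<open>K n\<close> lies in the preimage of the annulus under
  \<open>p3\<close>, hence outside \<open>ball 0 s\<close>. That ball contains \<open>A\<close> and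
  is connected, so it lies on the same side of \<open>K n\<close> as 0.\<close>

lemma surr_le_A: "surr_le A (K n)"
proof (cases n)
  case 0
  then show ?thesis by (simp add: K_0 surr_le_def)
next
  case (Suc m)
  obtain U W where UW: "separated_by r R (K n) U W" using ring_K unfolding ring_continuum_def by blast
  then have S: "open U" "open W" "U \<inter> W = {}" "U \<union> W = - K n" "ball 0 r \<subseteq> U"
    unfolding separated_by_def by auto
  have "K n \<subseteq> poly p3 -` D" unfolding Suc K_Suc using K_subset limset_subset by blast
  then have "ball 0 s \<inter> K n = {}" using p3_vimage by fastforce
  then have "ball 0 s \<subseteq> U \<union> W" "U \<inter> W \<inter> ball 0 s = {}" using S(3,4) by auto
  moreover have "connected (ball (0::complex) s)" by simp
  ultimately have "U \<inter> ball 0 s = {} \<or> W \<inter> ball 0 s = {}" using connectedD S(1,2) by blast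
  moreover have "0 \<in> U \<inter> ball 0 s"
  proof -
    obtain z where "z \<in> A" using compact_K(3)[of 0] K_0 by blast
    then have "norm z < s" using A_subset(2) by auto
    then have "0 < s" using norm_ge_zero[of z] by linarith
    then show ?thesis using S(5) r_pos by auto
  qed
  ultimately have "ball 0 s \<subseteq> U" using \<open>ball 0 s \<subseteq> U \<union> W\<close> by blast
  then have "A \<subseteq> U" using A_subset(2) by blast
  then show ?thesis using surr_le_if_separated[OF UW] compact_K(2,3)[of 0] K_0 by simp
qed

text \<open>A point of \<open>K n\<close> reaches \<open>A\<close> after n steps and the inner disc
  one step later, so \<open>K n\<close> lies in the inner basin, which is the bounded side of
  \<open>J3\<close>.\<close>

lemma surr_le_J3: "surr_le (K n) J3"
proof -
  have "K n \<subseteq> basin (poly p3) (ball 0 r)"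
  proof
    fix z assume "z \<in> K n"
    then have "norm ((poly p3 ^^ n) z) < s" using A_subset(2) unfolding K_def by auto
    then have "norm ((poly p3 ^^ Suc n) z) < r" using p3_inner by simp
    then show "z \<in> basin (poly p3) (ball 0 r)" unfolding basin_def by (intro UN_I[of "Suc n"]) auto
  qed
  then show ?thesis
    unfolding J3_def using compact_K(2,3)
    by (intro surr_le_if_separated[OF separated_by_limset_singleton[of p3]]) auto
qed

end

section \<open>Postcritical sets and Julia components\<close>

text \<open>Subtracting a shorter vector from \<open>c\<close> turns it by less than a right
  angle.\<close>

lemma Re_divide_diff_pos:
  fixes a c :: complex
  assumes "norm a < norm c"
  shows "Re (c / (c - a)) > 0"
proof -
  have ne: "c - a \<noteq> 0" using assms by auto
  have "Re (c * cnj (c - a)) = (norm c)\<^sup>2 - Re (c * cnj a)"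
    by (simp add: algebra_simps complex_norm_square[symmetric] cmod_power2 flip: power2_eq_square)
  moreover have "Re (c * cnj a) \<le> norm c * norm a"
    using complex_Re_le_cmod[of "c * cnj a"] by (simp add: norm_mult)
  moreover have "norm c * norm a < (norm c)\<^sup>2"
    unfolding power2_eq_square using assms norm_ge_zero[of a]
    by (intro mult_strict_left_mono) linarith+
  ultimately have "Re (c * cnj (c - a)) > 0" by linarith
  moreover have "c / (c - a) = c * cnj (c - a) / of_real ((norm (c - a))\<^sup>2)"
    using ne by (simp only: complex_norm_square divide_simps) (simp add: mult_ac)
  ultimately show ?thesis using ne by (simp only: Re_divide_of_real) simp
qed

text \<open>A form of the Gauss-Lucas theorem: \<open>c * p'(c) / p(c)\<close> is the sum of
  \<open>c / (c - a)\<close> over the zeros \<open>a\<close>, and each term has positive real part.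
  So there are no critical points off a disc about 0 containing the zeros.\<close>

lemma Re_log_deriv_pos:
  fixes p :: "complex poly"
  assumes "degree p \<ge> 1" "\<And>z. poly p z = 0 \<Longrightarrow> norm z < r" "r \<le> norm c"
  shows "Re (c * poly (pderiv p) c / poly p c) > 0"
  using assms(1,2)
proof (induction "degree p" arbitrary: p)
  case (Suc n)
  obtain a where a: "poly p a = 0" using surj_poly[of p 0] Suc.prems(1) by blast
  then obtain q where q: "p = [:- a, 1:] * q" using poly_eq_0_iff_dvd[of p a] by blast
  have q0: "q \<noteq> 0" using q Suc.prems(1) by auto
  then have "degree p = degree [:- a, 1:] + degree q" unfolding q by (intro degree_mult_eq) auto
  then have dq: "degree q = n" using Suc.hyps(2) by simp
  have ac: "norm a < norm c" using Suc.prems(2)[OF a] assms(3) by simp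
  then have ca: "c - a \<noteq> 0" by auto
  have rq: "norm z < r" if "poly q z = 0" for z using that by (intro Suc.prems(2)) (simp add: q)
  have qc: "poly q c \<noteq> 0" using rq[of c] assms(3) by auto
  have "pderiv p = q + [:- a, 1:] * pderiv q"
    unfolding q pderiv_mult by (simp add: pderiv_pCons)
  then have "poly (pderiv p) c = poly (q + [:- a, 1:] * pderiv q) c" by (simp only:)
  also have "\<dots> = poly q c + (c - a) * poly (pderiv q) c" by (simp add: algebra_simps)
  finally have "poly (pderiv p) c = poly q c + (c - a) * poly (pderiv q) c" .
  moreover have "poly p c = (c - a) * poly q c" by (simp add: q algebra_simps)
  ultimately have "c * poly (pderiv p) c / poly p c = c / (c - a) + c * poly (pderiv q) c / poly q c"
    using ca qc by (simp add: divide_simps) (simp add: algebra_simps)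
  \<comment> \<open>Only a weak inequality is available here, since the cofactor \<open>q\<close>
    may be constant; the zero just split off supplies strictness.\<close>
  moreover have "Re (c * poly (pderiv q) c / poly q c) \<ge> 0"
  proof (cases "n = 0")
    case True
    then have "pderiv q = 0" using dq by (simp add: pderiv_eq_0_iff)
    then show ?thesis by simp
  next
    case False
    then show ?thesis using Suc.hyps(1)[of q] dq rq by (simp add: less_imp_le)
  qed
  ultimately show ?case using Re_divide_diff_pos[OF ac] by simp
qed simp

lemma critical_point_poly_map: "critical_point (poly_map p) (Fin c) \<longleftrightarrow> poly (pderiv p) c = 0"
proof -
  have "critical_point (poly_map p) (Fin c) \<longleftrightarrow> (poly p has_field_derivative 0) (at c)"
    unfolding critical_point_def by (simp add: coord_def coord_inv_def)
  also have "\<dots> \<longleftrightarrow> poly (pderiv p) c = 0"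
    using poly_DERIV[of p c] DERIV_unique by metis
  finally show ?thesis .
qed

context expanding_system
begin

text \<open>Generators have their critical points, hence their critical values, in the inner disc. A
  critical point of a composite is critical for the inner factor or mapped to one of the outer
  factor, and forward invariance of the disc settles the first case.\<close>

lemma sgen_critical:
  assumes "g \<in> sgen (poly_map ` P)"
  shows "\<exists>p. g = poly_map p \<and> (\<forall>z. norm z < r \<longrightarrow> norm (poly p z) < r) \<and>
    (\<forall>z. poly (pderiv p) z = 0 \<longrightarrow> norm (poly p z) < r)"
  using assms
proof induction
  case (base h)
  then obtain p where p: "p \<in> P" "h = poly_map p" by blast
  have "norm (poly p z) < r" if "poly (pderiv p) z = 0" for z
  proof (cases "r \<le> norm z")
    case True
    have "degree p \<ge> 1" using deg[OF p(1)] by simp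
    from Re_log_deriv_pos[OF this roots[OF p(1)] True] that show ?thesis by simp
  next
    case False
    then show ?thesis using inner[OF p(1)] by simp
  qed
  then show ?case using p inner[OF p(1)] by (intro exI[of _ p]) simp
next
  case (comp f g)
  then obtain p q where pq: "f = poly_map p" "g = poly_map q"
    "\<forall>z. norm z < r \<longrightarrow> norm (poly p z) < r" "\<forall>z. norm z < r \<longrightarrow> norm (poly q z) < r"
    "\<forall>z. poly (pderiv p) z = 0 \<longrightarrow> norm (poly p z) < r"
    "\<forall>z. poly (pderiv q) z = 0 \<longrightarrow> norm (poly q z) < r" by blast
  then show ?case
    by (intro exI[of _ "pcompose p q"]) (auto simp: poly_map_pcompose poly_pcompose pderiv_pcompose)
qed

lemma bounded_postcritical: "bounded (postcritical_fin (sgen (poly_map ` P)))"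
proof -
  have "critical_values g \<subseteq> insert Infty (Fin ` cball 0 r)" if g: "g \<in> sgen (poly_map ` P)" for g
  proof
    fix v assume "v \<in> critical_values g"
    then obtain x where x: "critical_point g x" "v = g x" unfolding critical_values_def by blast
    obtain p where p: "g = poly_map p" "\<forall>z. poly (pderiv p) z = 0 \<longrightarrow> norm (poly p z) < r"
      using sgen_critical[OF g] by blast
    show "v \<in> insert Infty (Fin ` cball 0 r)"
    proof (cases x)
      case (Fin c)
      then have "norm (poly p c) < r" using x p critical_point_poly_map by simp
      then show ?thesis using x(2) Fin p(1) by simp
    qed (simp add: x(2) p(1))
  qed
  \<comment> \<open>\<open>Infty\<close> has to be allowed, being fixed by all maps and possibly
    critical; \<open>postcritical_fin\<close> discards it afterwards.\<close>
  moreover have "closed (insert Infty (Fin ` cball 0 r))"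
    by (intro closed_insert compact_imp_closed compact_Fin_image compact_cball)
  ultimately have "postcritical (sgen (poly_map ` P)) \<subseteq> insert Infty (Fin ` cball 0 r)"
    unfolding postcritical_def by (intro closure_minimal) auto
  then have "postcritical_fin (sgen (poly_map ` P)) \<subseteq> cball 0 r"
    unfolding postcritical_fin_def by auto
  then show ?thesis by (rule bounded_subset[OF bounded_cball])
qed

lemma sgen_in_G: "sgen (poly_map ` P) \<in> \<G>"
proof -
  have "polynomial_semigroup (sgen (poly_map ` P))"
    unfolding polynomial_semigroup_def
  proof (intro exI conjI)
    show "poly_map ` P \<noteq> {}" using P_ne by simp
    show "poly_map ` P \<subseteq> Poly_nonconst" unfolding Poly_nonconst_def using deg by force
  qed simp
  moreover have "sgen (poly_map ` P) \<subseteq> Poly_deg_ge2"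
    unfolding Poly_deg_ge2_def using sgen_poly_map by blast
  ultimately show ?thesis unfolding \<G>_def using bounded_postcritical by blast
qed

lemma Julia1_poly_map:
  assumes "p \<in> P"
  shows "Julia1 (poly_map p) = Fin ` limset {p} D"
proof -
  interpret S: expanding_system "{p}" r R lam by (rule subsystem) (use assms in auto)
  show ?thesis unfolding Julia1_def using S.Julia_eq by simp
qed

end

section \<open>Components of the Julia set of the three-generator semigroup\<close>

context three_maps
begin

abbreviation "G \<equiv> sgen {poly_map p1, poly_map p2, poly_map p3}"

lemma G_eq: "G = sgen (poly_map ` {p1, p2, p3})"
  by simp

lemma Julia_G: "Julia G = Fin ` X"
  unfolding G_eq by (rule Julia_eq)

lemma Jhat_G: "Jhat G = insert (Fin ` J3) (range (\<lambda>n. Fin ` K n))"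
  unfolding Jhat_def Julia_G
proof (rule components_eqI)
  show "Fin ` X = \<Union> (insert (Fin ` J3) (range (\<lambda>n. Fin ` K n)))"
    by (subst X_cover) auto
  have J3: "connected J3" "J3 \<noteq> {}"
    using ring_J3 ring_nonempty[OF ring_J3 r_pos] unfolding ring_continuum_def by auto
  fix C assume C: "C \<in> insert (Fin ` J3) (range (\<lambda>n. Fin ` K n))"
  then show "connected C" "C \<noteq> {}" using J3 compact_K by (auto intro: connected_Fin_image)
  fix T assume T: "connected T" "T \<subseteq> Fin ` X" "T \<inter> C \<noteq> {}"
  have T': "connected (Fin -` T)" "Fin -` T \<subseteq> X"
    using T(1,2) by (auto intro!: connected_Fin_vimage)
  obtain S where S: "C = Fin ` S" "Fin -` T \<inter> S \<noteq> {} \<Longrightarrow> Fin -` T \<subseteq> S"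
    using C connected_subset_J3[OF T'] connected_subset_K[OF T'] by (elim insertE rangeE) metis+
  obtain z where "Fin z \<in> T" "z \<in> S" using T(3) S(1) by auto
  then have TS: "Fin -` T \<subseteq> S" using S(2) by blast
  have "T = Fin ` (Fin -` T)" using T(2) by blast
  also have "\<dots> \<subseteq> C" unfolding S(1) by (rule image_mono[OF TS])
  finally show "T \<subseteq> C" .
qed

lemma Jfin_G: "Jfin G = Jhat G"
  unfolding Jfin_def Jhat_G by auto

lemma Fin_vimage_image: "Fin -` Fin ` S = S"
  by auto

lemma inj_K: "inj (\<lambda>n. Fin ` K n)"
proof (rule injI)
  fix m n assume "Fin ` K m = Fin ` K n"
  then have eq: "K m = K n" by (metis Fin_vimage_image)
  show "m = n"
  proof (rule ccontr)
    assume "m \<noteq> n"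
    then have "K m \<inter> K n = {}" using K_disjoint[of m n] K_disjoint[of n m] by (cases "m < n") auto
    then show False using eq compact_K(3)[of n] by simp
  qed
qed

lemma infinite_Jhat: "infinite (Jhat G)"
  unfolding Jhat_G using range_inj_infinite[OF inj_K] by simp

lemma Jhat_eqpoll: "Jhat G \<approx> (UNIV :: nat set)"
proof -
  have "countable (Jhat G)" unfolding Jhat_G by simp
  then obtain f :: "rsphere set \<Rightarrow> nat" where "bij_betw f (Jhat G) UNIV"
    using infinite_Jhat by (rule countableE_infinite)
  then show ?thesis unfolding eqpoll_def by blast
qed

lemma G_in_G_dis: "G \<in> \<G>_dis"
proof -
  have "\<not> connected (Julia G)"
  proof
    assume con: "connected (Julia G)"
    have "components (Julia G) = {Julia G}"
    proof (rule components_eqI)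
      show "C \<noteq> {}" if "C \<in> {Julia G}" for C
        using that infinite_Jhat unfolding Jhat_def by auto
    qed (use con in auto)
    then show False using infinite_Jhat unfolding Jhat_def by simp
  qed
  then show ?thesis using sgen_in_G unfolding \<G>_dis_def by simp
qed

lemma compact_Jfin:
  assumes "C \<in> Jfin G"
  shows "compact (Fin -` C)" "Fin -` C \<noteq> {}"
  using assms ring_J3 ring_nonempty[OF ring_J3 r_pos] compact_K
  unfolding Jfin_G Jhat_G ring_continuum_def by (auto simp: Fin_vimage_image)

lemma Jmin_G: "Jmin G = Fin ` A"
  unfolding Jmin_def
proof (rule the_equality)
  have A: "Fin ` A \<in> Jfin G" unfolding Jfin_G Jhat_G using K_0 by (metis insertI2 rangeI)
  have "surr_le A J3" using surr_le_J3[of 0] K_0 by simp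
  then have le: "\<forall>J\<in>Jfin G. surr_le (Fin -` Fin ` A) (Fin -` J)"
    unfolding Jfin_G Jhat_G using surr_le_A by (auto simp: Fin_vimage_image)
  with A show "Fin ` A \<in> Jfin G \<and> (\<forall>J\<in>Jfin G. surr_le (Fin -` Fin ` A) (Fin -` J))" ..
  fix C assume C: "C \<in> Jfin G \<and> (\<forall>J\<in>Jfin G. surr_le (Fin -` C) (Fin -` J))"
  then have CJ: "C \<in> Jfin G" "surr_le (Fin -` C) (Fin -` Fin ` A)" using A by auto
  have eq: "Fin -` C = Fin -` Fin ` A"
    by (rule surr_le_antisym[OF CJ(2) le[rule_format, OF CJ(1)] compact_Jfin(1)[OF CJ(1)] compact_Jfin(1)[OF A]
        compact_Jfin(2)[OF CJ(1)] compact_Jfin(2)[OF A]])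
  have "C \<subseteq> range Fin" using CJ(1) unfolding Jfin_def by simp
  then have "C = Fin ` (Fin -` C)" by blast
  also have "\<dots> = Fin ` A" unfolding eq by (simp only: Fin_vimage_image)
  finally show "C = Fin ` A" .
qed

lemma Jmax_G: "Jmax G = Fin ` J3"
  unfolding Jmax_def
proof (rule the_equality)
  have J3: "Fin ` J3 \<in> Jfin G" unfolding Jfin_G Jhat_G by simp
  have le: "\<forall>J\<in>Jfin G. surr_le (Fin -` J) (Fin -` Fin ` J3)"
    unfolding Jfin_G Jhat_G using surr_le_J3 by (auto simp: Fin_vimage_image surr_le_def[of J3 J3])
  with J3 show "Fin ` J3 \<in> Jfin G \<and> (\<forall>J\<in>Jfin G. surr_le (Fin -` J) (Fin -` Fin ` J3))" ..
  fix C assume C: "C \<in> Jfin G \<and> (\<forall>J\<in>Jfin G. surr_le (Fin -` J) (Fin -` C))"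
  then have CJ: "C \<in> Jfin G" "surr_le (Fin -` Fin ` J3) (Fin -` C)" using J3 by auto
  have eq: "Fin -` C = Fin -` Fin ` J3"
    by (rule surr_le_antisym[OF le[rule_format, OF CJ(1)] CJ(2) compact_Jfin(1)[OF CJ(1)] compact_Jfin(1)[OF J3]
        compact_Jfin(2)[OF CJ(1)] compact_Jfin(2)[OF J3]])
  have "C \<subseteq> range Fin" using CJ(1) unfolding Jfin_def by simp
  then have "C = Fin ` (Fin -` C)" by blast
  also have "\<dots> = Fin ` J3" unfolding eq by (simp only: Fin_vimage_image)
  finally show "C = Fin ` J3" .
qed

text \<open>Polynomials are surjective, so some point lies over \<open>J3\<close>. As
  \<open>J3\<close> is part of \<open>X\<close>, that point belongs to \<open>A\<close> by
  definition.\<close>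

lemma vimage_J3_meets_A:
  assumes "p \<in> {p1, p2}"
  shows "poly_map p -` Fin ` J3 \<inter> Fin ` A \<noteq> {}"
proof -
  have p: "p \<in> {p1, p2, p3}" using assms by blast
  obtain w where w: "w \<in> J3" using ring_nonempty[OF ring_J3 r_pos] by blast
  have "degree p \<ge> 1" using deg[OF p] by simp
  then obtain z where z: "poly p z = w" using surj_poly by blast
  then have "poly p z \<in> X" using w J3_subset by blast
  then have "z \<in> A" using assms unfolding A_def by auto
  then show ?thesis using z w by (intro ex_in_conv[THEN iffD1] exI[of _ "Fin z"]) auto
qed

lemma G_properties:
  "G \<in> \<G>_dis \<and> Julia1 (poly_map p1) \<union> Julia1 (poly_map p2) \<subseteq> Jmin G \<and>
   Jmax G = Julia1 (poly_map p3) \<and>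
   (\<forall>h\<in>{poly_map p1, poly_map p2}. h -` Julia1 (poly_map p3) \<inter> Jmin G \<noteq> {}) \<and>
   Jhat G \<approx> (UNIV :: nat set)"
proof -
  have J: "Julia1 (poly_map p) = Fin ` limset {p} D" if "p \<in> {p1, p2, p3}" for p
    using that by (rule Julia1_poly_map)
  have 1: "Julia1 (poly_map p1) \<union> Julia1 (poly_map p2) \<subseteq> Jmin G"
    unfolding Jmin_G using J limset_singleton_subset_A[of p1] limset_singleton_subset_A[of p2]
    by (simp add: image_mono)
  have 2: "Julia1 (poly_map p3) = Fin ` J3" using J[of p3] by (simp add: J3_def)
  show ?thesis
    unfolding 2 using G_in_G_dis 1 Jmax_G Jhat_eqpoll
      vimage_J3_meets_A[of p1] vimage_J3_meets_A[of p2] by (simp add: Jmin_G)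
qed

end

section \<open>Perturbing the model maps\<close>

text \<open>The compact graph of \<open>f\<close> over \<open>K\<close> has a whole neighbourhood
  inside \<open>V\<close>. Using open sets of pairs lets the condition depend on the point as well,
  and the filter form lets finitely many such conditions share one radius.\<close>

lemma unif_dist_stable:
  assumes K: "compact K" and f: "continuous_on K f" and V: "open V"
    and graph: "\<And>x. x \<in> K \<Longrightarrow> (x, f x) \<in> V"
  shows "\<forall>\<^sub>F \<epsilon> in at_right 0. \<forall>g. unif_dist f g < \<epsilon> \<longrightarrow> (\<forall>x\<in>K. (x, g x) \<in> V)"
proof -
  have "compact ((\<lambda>x. (x, f x)) ` K)"
    using K f by (intro compact_continuous_image continuous_intros)
  moreover have "(\<lambda>x. (x, f x)) ` K \<subseteq> V" using graph by blast
  ultimately obtain e where e: "e > 0" "(\<Union>y\<in>(\<lambda>x. (x, f x)) ` K. ball y e) \<subseteq> V"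
    by (rule compact_subset_open_imp_ball_epsilon_subset[OF _ V])
  have "(x, g x) \<in> V" if "unif_dist f g < \<epsilon>" "\<epsilon> < e" "x \<in> K" for g \<epsilon> x
  proof -
    have "dist (x, f x) (x, g x) < e"
      using dist_le_unif_dist[of f x g] that by (simp add: dist_Pair_Pair)
    then have "(x, g x) \<in> ball (x, f x) e" by simp
    then show ?thesis using e(2) that(3) by blast
  qed
  then show ?thesis
    unfolding eventually_at_right_field using e(1) by (intro exI[of _ e]) blast
qed

lemma poly_map_stable_image:
  assumes q: "degree q \<ge> 1" and K: "compact K" and V: "open V" and qK: "poly_map q ` K \<subseteq> V"
  shows "\<forall>\<^sub>F \<epsilon> in at_right 0. \<forall>p. unif_dist (poly_map q) (poly_map p) < \<epsilon> \<longrightarrow> poly_map p ` K \<subseteq> V"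
proof -
  have "\<forall>\<^sub>F \<epsilon> in at_right 0. \<forall>g. unif_dist (poly_map q) g < \<epsilon> \<longrightarrow> (\<forall>x\<in>K. (x, g x) \<in> UNIV \<times> V)"
    using qK by (intro unif_dist_stable K continuous_on_poly_map q open_Times V open_UNIV) auto
  then show ?thesis by (rule eventually_mono) blast
qed

text \<open>Turns spherical into Euclidean closeness on a disc: being within \<open>\<eta>\<close>
  of \<open>q(z)\<close> is an open condition on the pair of argument and value.\<close>

lemma poly_map_stable_close:
  fixes M \<eta> :: real
  assumes q: "degree q \<ge> 1" and \<eta>: "\<eta> > 0"
  shows "\<forall>\<^sub>F \<epsilon> in at_right 0. \<forall>p. unif_dist (poly_map q) (poly_map p) < \<epsilon> \<longrightarrow>
           (\<forall>z\<in>cball 0 M. norm (poly p z - poly q z) < \<eta>)"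
proof -
  define S where "S = range Fin \<times> range Fin"
  define f where "f x = the_fin (snd x) - poly q (the_fin (fst x))" for x
  have "open (range Fin)" by (rule open_Fin_image[OF open_UNIV])
  then have S: "open S" unfolding S_def by (intro open_Times)
  have "continuous_on S (\<lambda>x. the_fin (snd x))" "continuous_on S (\<lambda>x. the_fin (fst x))"
    unfolding S_def
    by (rule continuous_on_compose2[OF continuous_on_the_fin]; auto intro: continuous_intros)+
  then have "continuous_on S f" unfolding f_def by (intro continuous_intros)
  then have "open (f -` ball 0 \<eta> \<inter> S)" using S by (simp add: continuous_on_open_vimage)
  then have "\<forall>\<^sub>F \<epsilon> in at_right 0. \<forall>g. unif_dist (poly_map q) g < \<epsilon> \<longrightarrow>
      (\<forall>x\<in>Fin ` cball 0 M. (x, g x) \<in> f -` ball 0 \<eta> \<inter> S)"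
    using \<eta> by (intro unif_dist_stable compact_Fin_image continuous_on_poly_map q compact_cball)
       (auto simp: f_def S_def)
  then show ?thesis
    by (rule eventually_mono) (auto simp: f_def)
qed

text \<open>Cauchy's estimate for the difference on a disc of radius 1. This is why control on
  radius 5 is needed for derivatives on radius 4.\<close>

lemma pderiv_close:
  fixes p q :: "complex poly"
  assumes "\<And>w. w \<in> cball z 1 \<Longrightarrow> norm (poly p w - poly q w) \<le> \<eta>"
  shows "norm (poly (pderiv p) z - poly (pderiv q) z) \<le> \<eta>"
proof -
  have "norm ((deriv ^^ 1) (poly (p - q)) z) \<le> fact 1 * \<eta> / 1 ^ 1"
    by (rule Cauchy_inequality) (use assms in \<open>auto intro!: holomorphic_intros continuous_intros simp: dist_norm\<close>)
  then show ?thesis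
    using DERIV_imp_deriv[OF poly_DERIV, of "p - q" z] by (simp add: pderiv_diff)
qed

section \<open>Estimates for the explicit models\<close>

definition model :: "real \<Rightarrow> real \<Rightarrow> complex poly" where
  "model k c = smult (of_real k) ([:- of_real c, 1:] ^ 16)"

lemma poly_model: "poly (model k c) z = of_real k * (z - of_real c) ^ 16"
  by (simp add: model_def)

lemma degree_model: "k \<noteq> 0 \<Longrightarrow> degree (model k c) = 16"
  by (simp add: model_def degree_power_eq)

lemma pderiv_model: "(z - of_real c) * poly (pderiv (model k c)) z = 16 * poly (model k c) z"
proof -
  have "pderiv (model k c) = smult (of_real k) (smult 16 ([:- of_real c, 1:] ^ 15))"
    using pderiv_power_Suc[of "[:- complex_of_real c, 1:]" 15]
    by (simp add: model_def pderiv_smult pderiv_pCons)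
  then show ?thesis
    using power_Suc[of "z - of_real c" 15] by (simp add: poly_model mult_ac)
qed

text \<open>The model value has norm at least 1/2 - 1/10 = 4/10 and \<open>z - c\<close> has norm at
  most 17/4. By \<open>pderiv_model\<close> the model derivative is at least 16 * (4/10) / (17/4) >
  3/2, and the perturbation costs at most 1/10.\<close>

lemma near_model_expanding:
  assumes c: "0 \<le> c" "c \<le> 1/4"
    and close: "\<And>w. norm w \<le> 5 \<Longrightarrow> norm (poly p w - poly (model k c) w) < 1/10"
    and z: "norm z \<le> 4" "1/2 \<le> norm (poly p z)"
  shows "5/4 \<le> norm (poly (pderiv p) z)"
proof -
  let ?q = "model k c"
  have "norm (poly p w - poly ?q w) \<le> 1/10" if "w \<in> cball z 1" for w
  proof -
    have "norm w \<le> norm z + norm (w - z)" by (rule norm_triangle_sub)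
    then have "norm w \<le> 5" using that z(1) by (simp add: dist_norm norm_minus_commute)
    then show ?thesis using close by (simp add: less_imp_le)
  qed
  then have d: "norm (poly (pderiv p) z - poly (pderiv ?q) z) \<le> 1/10" by (rule pderiv_close)
  have "norm (poly p z) \<le> norm (poly ?q z) + norm (poly p z - poly ?q z)" by (rule norm_triangle_sub)
  then have q: "4/10 \<le> norm (poly ?q z)" using close[of z] z by simp
  have "norm (z - of_real c) \<le> norm z + norm (complex_of_real c)" by (rule norm_triangle_ineq4)
  then have zc: "norm (z - of_real c) \<le> 17/4" using z(1) c by simp
  have "16 * norm (poly ?q z) = norm ((z - of_real c) * poly (pderiv ?q) z)"
    unfolding pderiv_model by (simp add: norm_mult)
  also have "\<dots> \<le> 17/4 * norm (poly (pderiv ?q) z)"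
    unfolding norm_mult using zc by (intro mult_right_mono) auto
  finally have "16 * (4/10) \<le> 17/4 * norm (poly (pderiv ?q) z)" using q by linarith
  moreover have "norm (poly (pderiv ?q) z) \<le> norm (poly (pderiv p) z) + norm (poly (pderiv p) z - poly (pderiv ?q) z)"
    using norm_triangle_sub[of "poly (pderiv ?q) z" "poly (pderiv p) z"] by (simp add: norm_minus_commute)
  ultimately show ?thesis using d by linarith
qed

text \<open>The first two clauses are centred at the zero \<open>c\<close> of the model; the other
  two are centred at 0 because they concern the inner disc and annulus shared by all three
  maps.\<close>

definition admissible :: "real \<Rightarrow> real \<Rightarrow> real \<Rightarrow> complex poly \<Rightarrow> bool" where
  "admissible c a b p \<longleftrightarrow>
     (\<forall>z. norm (z - of_real c) \<le> a \<longrightarrow> norm (poly p z) < 1/2) \<and>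
     (\<forall>z. b \<le> norm (z - of_real c) \<longrightarrow> 4 < norm (poly p z)) \<and>
     (\<forall>z. poly p z = 0 \<longrightarrow> norm z < 1/2) \<and>
     (\<forall>z. norm z \<le> 4 \<longrightarrow> 1/2 \<le> norm (poly p z) \<longrightarrow> 5/4 \<le> norm (poly (pderiv p) z))"

text \<open>For the model each clause follows from an open condition over a compact set, and so
  survives small perturbation. Near infinity this works because the exterior together with
  \<open>Infty\<close> is compact in the sphere.\<close>

lemma eventually_admissible:
  assumes k: "k > 0" and c: "0 \<le> c" "c \<le> 1/4" and a: "0 \<le> a" "k * a ^ 16 < 1/2" and b: "0 < b" "4 < k * b ^ 16"
  shows "\<forall>\<^sub>F \<epsilon> in at_right 0. \<forall>p. unif_dist (poly_map (model k c)) (poly_map p) < \<epsilon> \<longrightarrow> admissible c a b p"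
proof -
  let ?q = "model k c"
  have deg: "degree ?q \<ge> 1" using k by (simp add: degree_model)
  have q: "norm (poly ?q z) = k * norm (z - of_real c) ^ 16" for z
    using k by (simp add: poly_model norm_mult norm_power)
  have "\<forall>\<^sub>F \<epsilon> in at_right 0. \<forall>p. unif_dist (poly_map ?q) (poly_map p) < \<epsilon> \<longrightarrow>
      poly_map p ` Fin ` cball (of_real c) a \<subseteq> Fin ` ball 0 (1/2)"
  proof (rule poly_map_stable_image[OF deg])
    have "norm (poly ?q z) < 1/2" if "norm (z - of_real c) \<le> a" for z
    proof -
      have "k * norm (z - of_real c) ^ 16 \<le> k * a ^ 16" using that k by (intro mult_left_mono power_mono) auto
      then show ?thesis using a(2) q[of z] by simp
    qed
    then show "poly_map ?q ` Fin ` cball (of_real c) a \<subseteq> Fin ` ball 0 (1/2)"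
      by (auto simp: dist_norm norm_minus_commute)
  qed (auto intro: compact_Fin_image open_Fin_image)
  moreover have "\<forall>\<^sub>F \<epsilon> in at_right 0. \<forall>p. unif_dist (poly_map ?q) (poly_map p) < \<epsilon> \<longrightarrow>
      poly_map p ` (- Fin ` ball (of_real c) b) \<subseteq> outer 4"
  proof (rule poly_map_stable_image[OF deg])
    show "compact (- Fin ` ball (complex_of_real c) b)"
      by (intro compact_rsphere_closed closed_Compl open_Fin_image open_ball)
    have "4 < norm (poly ?q z)" if "b \<le> norm (z - of_real c)" for z
    proof -
      have "k * b ^ 16 \<le> k * norm (z - of_real c) ^ 16" using that k b(1) by (intro mult_left_mono power_mono) auto
      then show ?thesis using b(2) q[of z] by simp
    qed
    then show "poly_map ?q ` (- Fin ` ball (of_real c) b) \<subseteq> outer 4"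
    proof (intro image_subsetI)
      fix x assume big: "\<And>z. b \<le> norm (z - of_real c) \<Longrightarrow> 4 < norm (poly ?q z)"
        and x: "x \<in> - Fin ` ball (of_real c) b"
      show "poly_map ?q x \<in> outer 4"
        using x big by (cases x) (auto simp: outer_def dist_norm norm_minus_commute image_iff not_less)
    qed
  qed (rule open_outer)
  moreover have "\<forall>\<^sub>F \<epsilon> in at_right 0. \<forall>p. unif_dist (poly_map ?q) (poly_map p) < \<epsilon> \<longrightarrow>
      poly_map p ` couter (1/2) \<subseteq> - {Fin 0}"
  \<comment> \<open>The zeros are controlled by an open condition: on the compact set
    \<open>couter (1/2)\<close> the value stays in the complement of the point 0.\<close>
  proof (rule poly_map_stable_image[OF deg compact_couter])
    have "poly ?q z \<noteq> 0" if "1/2 \<le> norm z" for z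
    proof
      assume "poly ?q z = 0"
      then have "z = of_real c" using k by (simp add: poly_model)
      then show False using that c by simp
    qed
    then show "poly_map ?q ` couter (1/2) \<subseteq> - {Fin 0}" by (auto simp: couter_def)
  qed (simp add: open_Compl)
  moreover have "\<forall>\<^sub>F \<epsilon> in at_right 0. \<forall>p. unif_dist (poly_map ?q) (poly_map p) < \<epsilon> \<longrightarrow>
      (\<forall>z\<in>cball 0 5. norm (poly p z - poly ?q z) < 1/10)"
    by (rule poly_map_stable_close[OF deg]) simp
  ultimately have "\<forall>\<^sub>F \<epsilon> in at_right 0. \<forall>p. unif_dist (poly_map ?q) (poly_map p) < \<epsilon> \<longrightarrow>
      poly_map p ` Fin ` cball (of_real c) a \<subseteq> Fin ` ball 0 (1/2) \<and>
      poly_map p ` (- Fin ` ball (of_real c) b) \<subseteq> outer 4 \<and>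
      poly_map p ` couter (1/2) \<subseteq> - {Fin 0} \<and>
      (\<forall>z\<in>cball 0 5. norm (poly p z - poly ?q z) < 1/10)"
    by eventually_elim simp
  then show ?thesis
  proof (rule eventually_mono)
    fix \<epsilon>
    assume elim: "\<forall>p. unif_dist (poly_map ?q) (poly_map p) < \<epsilon> \<longrightarrow>
      poly_map p ` Fin ` cball (of_real c) a \<subseteq> Fin ` ball 0 (1/2) \<and>
      poly_map p ` (- Fin ` ball (of_real c) b) \<subseteq> outer 4 \<and>
      poly_map p ` couter (1/2) \<subseteq> - {Fin 0} \<and>
      (\<forall>z\<in>cball 0 5. norm (poly p z - poly ?q z) < 1/10)"
    show "\<forall>p. unif_dist (poly_map ?q) (poly_map p) < \<epsilon> \<longrightarrow> admissible c a b p"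
    proof (intro allI impI)
      fix p assume d: "unif_dist (poly_map ?q) (poly_map p) < \<epsilon>"
      have 1: "poly_map p ` Fin ` cball (of_real c) a \<subseteq> Fin ` ball 0 (1/2)"
        and 2: "poly_map p ` (- Fin ` ball (of_real c) b) \<subseteq> outer 4"
        and 3: "poly_map p ` couter (1/2) \<subseteq> - {Fin 0}"
        and 4: "\<forall>z\<in>cball 0 5. norm (poly p z - poly ?q z) < 1/10"
        using elim[rule_format, OF d] by simp_all
      have "norm (poly p z) < 1/2" if "norm (z - of_real c) \<le> a" for z
      proof -
        have "Fin z \<in> Fin ` cball (of_real c) a" using that by (simp add: dist_norm norm_minus_commute image_iff)
        then have "poly_map p (Fin z) \<in> Fin ` ball 0 (1/2)" using 1 by blast
        then show ?thesis by auto
      qed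
      moreover have "4 < norm (poly p z)" if "b \<le> norm (z - of_real c)" for z
      proof -
        have "Fin z \<in> - Fin ` ball (of_real c) b" using that by (simp add: dist_norm norm_minus_commute image_iff not_less)
        then have "poly_map p (Fin z) \<in> outer 4" using 2 by blast
        then show ?thesis by (auto simp: outer_def)
      qed
      moreover have "norm z < 1/2" if "poly p z = 0" for z
      proof (rule ccontr)
        assume "\<not> norm z < 1/2"
        then have "Fin z \<in> couter (1/2)" by (simp add: couter_def image_iff)
        then have "poly_map p (Fin z) \<in> - {Fin 0}" using 3 by blast
        then show False using that by simp
      qed
      moreover have "5/4 \<le> norm (poly (pderiv p) z)" if "norm z \<le> 4" "1/2 \<le> norm (poly p z)" for z
        by (rule near_model_expanding[where k=k, OF c _ that]) (use 4 in simp)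
      ultimately show "admissible c a b p" unfolding admissible_def by blast
    qed
  qed
qed

text \<open>The radii fit: 11/10 is at most 9/10 + 1/4, and 11/10 + 1/4 = 27/20. For
  \<open>p2\<close> the shift by 1/4 is absorbed, since 1/2 + 1/4 is below 9/10 and 4 - 1/4 is above
  11/10.\<close>

lemma three_maps_admissible:
  assumes deg: "degree p1 \<ge> 2" "degree p2 \<ge> 2" "degree p3 \<ge> 2"
    and p1: "admissible 0 (9/10) (11/10) p1" and p2: "admissible (1/4) (9/10) (11/10) p2"
    and p3: "admissible 0 (27/20) 4 p3"
  shows "three_maps p1 p2 p3 (1/2) 4 (5/4) (9/10) (11/10) (1/4) (27/20)"
proof -
  have tri: "norm (z - complex_of_real (1/4)) \<le> norm z + 1/4" "norm z - 1/4 \<le> norm (z - complex_of_real (1/4))" for z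
    using norm_triangle_ineq4[of z "complex_of_real (1/4)"] norm_triangle_ineq2[of z "complex_of_real (1/4)"]
    unfolding norm_of_real by simp_all
  have inner1: "norm (poly p1 z) < 1/2" if "norm z \<le> 9/10" for z
    using p1 that unfolding admissible_def by simp
  have inner2: "norm (poly p2 z) < 1/2" if "norm (z - complex_of_real (1/4)) \<le> 9/10" for z
    using p2 that unfolding admissible_def by blast
  have inner3: "norm (poly p3 z) < 1/2" if "norm z \<le> 27/20" for z
    using p3 that unfolding admissible_def by simp
  have outer1: "4 < norm (poly p1 z)" if "11/10 \<le> norm z" for z
    using p1 that unfolding admissible_def by simp
  have outer2: "4 < norm (poly p2 z)" if "11/10 \<le> norm (z - complex_of_real (1/4))" for z
    using p2 that unfolding admissible_def by blast
  have outer3: "4 < norm (poly p3 z)" if "4 \<le> norm z" for z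
    using p3 that unfolding admissible_def by simp
  have adm: "\<exists>c a b. admissible c a b p" if "p \<in> {p1, p2, p3}" for p
    using that p1 p2 p3 by auto
  have inner: "norm (poly p z) < 1/2" if "p \<in> {p1, p2, p3}" "norm z \<le> 1/2" for p z
    using that inner1[of z] inner2[of z] inner3[of z] tri(1)[of z] by auto
  have outer: "4 < norm (poly p z)" if "p \<in> {p1, p2, p3}" "4 \<le> norm z" for p z
    using that outer1[of z] outer2[of z] outer3[of z] tri(2)[of z] by auto
  show ?thesis
  proof unfold_locales
    show "2 \<le> degree p" if "p \<in> {p1, p2, p3}" for p using that deg by auto
    show "norm z < 1/2" if "p \<in> {p1, p2, p3}" "poly p z = 0" for p z
      using adm[OF that(1)] that(2) unfolding admissible_def by blast
    show "5/4 \<le> norm (poly (pderiv p) z)" if "p \<in> {p1, p2, p3}" "poly p z \<in> annulus (1/2) 4" for p z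
    proof -
      have "1/2 \<le> norm (poly p z)" "norm (poly p z) \<le> 4" using that(2) by (auto simp: annulus_def)
      moreover from this have "norm z \<le> 4" using outer[OF that(1), of z] by linarith
      ultimately show ?thesis using adm[OF that(1)] unfolding admissible_def by blast
    qed
  qed (use inner outer inner1 inner2 inner3 outer1 outer2 in auto)
qed

theorem proposition2p27:
  "\<exists>V. openin (prod_topology Poly_top (prod_topology Poly_top Poly_top)) V \<and> V \<noteq> {} \<and>
     (\<forall>(h1, h2, h3) \<in> V.
        let G = sgen {h1, h2, h3} in
          G \<in> \<G>_dis \<and>
          Julia1 h1 \<union> Julia1 h2 \<subseteq> Jmin G \<and>
          Jmax G = Julia1 h3 \<and>
          (\<forall>h \<in> {h1, h2}. h -` Julia1 h3 \<inter> Jmin G \<noteq> {}) \<and>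
          Jhat G \<approx> (UNIV :: nat set))"
proof -
  interpret M: Metric_space Poly_deg_ge2 unif_dist by (rule Metric_space_unif_dist)
  \<comment> \<open>The bounds checked below are (9/10)^16 < 1/2 and (11/10)^16 > 4 for the first
    two models, and (27/20)^16 / 2^15 < 1/2 and 4^16 / 2^15 = 2^17 > 4 for the third.\<close>
  define q1 q2 q3 where "q1 = model 1 0" and "q2 = model 1 (1/4)" and "q3 = model (1 / 2^15) 0"
  have "\<forall>\<^sub>F \<epsilon> in at_right 0. \<forall>p. unif_dist (poly_map q1) (poly_map p) < \<epsilon> \<longrightarrow> admissible 0 (9/10) (11/10) p"
    unfolding q1_def by (rule eventually_admissible) (simp_all add: power_divide)
  moreover have "\<forall>\<^sub>F \<epsilon> in at_right 0. \<forall>p. unif_dist (poly_map q2) (poly_map p) < \<epsilon> \<longrightarrow> admissible (1/4) (9/10) (11/10) p"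
    unfolding q2_def by (rule eventually_admissible) (simp_all add: power_divide)
  moreover have "\<forall>\<^sub>F \<epsilon> in at_right 0. \<forall>p. unif_dist (poly_map q3) (poly_map p) < \<epsilon> \<longrightarrow> admissible 0 (27/20) 4 p"
    unfolding q3_def by (rule eventually_admissible) (simp_all add: power_divide)
  moreover have "\<forall>\<^sub>F \<epsilon> in at_right (0::real). 0 < \<epsilon>" by (rule eventually_at_right_less)
  ultimately have "\<forall>\<^sub>F \<epsilon> in at_right 0. 0 < \<epsilon> \<and>
     (\<forall>p. unif_dist (poly_map q1) (poly_map p) < \<epsilon> \<longrightarrow> admissible 0 (9/10) (11/10) p) \<and>
     (\<forall>p. unif_dist (poly_map q2) (poly_map p) < \<epsilon> \<longrightarrow> admissible (1/4) (9/10) (11/10) p) \<and>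
     (\<forall>p. unif_dist (poly_map q3) (poly_map p) < \<epsilon> \<longrightarrow> admissible 0 (27/20) 4 p)"
    by eventually_elim simp
  then obtain \<epsilon> where \<epsilon>: "0 < \<epsilon>"
      "\<And>p. unif_dist (poly_map q1) (poly_map p) < \<epsilon> \<Longrightarrow> admissible 0 (9/10) (11/10) p"
      "\<And>p. unif_dist (poly_map q2) (poly_map p) < \<epsilon> \<Longrightarrow> admissible (1/4) (9/10) (11/10) p"
      "\<And>p. unif_dist (poly_map q3) (poly_map p) < \<epsilon> \<Longrightarrow> admissible 0 (27/20) 4 p"
    using eventually_happens'[OF trivial_limit_at_right_real] by (metis (no_types, lifting))
  define V where "V = M.mball (poly_map q1) \<epsilon> \<times> M.mball (poly_map q2) \<epsilon> \<times> M.mball (poly_map q3) \<epsilon>"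
  have "degree q1 = 16" "degree q2 = 16" "degree q3 = 16"
    by (simp_all add: q1_def q2_def q3_def degree_model)
  then have "poly_map q1 \<in> Poly_deg_ge2" "poly_map q2 \<in> Poly_deg_ge2" "poly_map q3 \<in> Poly_deg_ge2"
    unfolding Poly_deg_ge2_def by auto
  then have "(poly_map q1, poly_map q2, poly_map q3) \<in> V" unfolding V_def using \<epsilon>(1) by simp
  moreover have "openin (prod_topology Poly_top (prod_topology Poly_top Poly_top)) V"
    unfolding V_def Poly_top_def by (simp add: openin_prod_Times_iff M.openin_mball)
  moreover have "let G = sgen {h1, h2, h3} in
          G \<in> \<G>_dis \<and>
          Julia1 h1 \<union> Julia1 h2 \<subseteq> Jmin G \<and>
          Jmax G = Julia1 h3 \<and>
          (\<forall>h \<in> {h1, h2}. h -` Julia1 h3 \<inter> Jmin G \<noteq> {}) \<and>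
          Jhat G \<approx> (UNIV :: nat set)" if h: "(h1, h2, h3) \<in> V" for h1 h2 h3
  proof -
    have "h1 \<in> Poly_deg_ge2" "h2 \<in> Poly_deg_ge2" "h3 \<in> Poly_deg_ge2"
      using h unfolding V_def by simp_all
    then obtain p1 p2 p3 where p: "h1 = poly_map p1" "h2 = poly_map p2" "h3 = poly_map p3"
        "degree p1 \<ge> 2" "degree p2 \<ge> 2" "degree p3 \<ge> 2"
      unfolding Poly_deg_ge2_def by blast
    have "unif_dist (poly_map q1) (poly_map p1) < \<epsilon>" "unif_dist (poly_map q2) (poly_map p2) < \<epsilon>"
         "unif_dist (poly_map q3) (poly_map p3) < \<epsilon>"
      using h unfolding V_def p(1-3) by simp_all
    then interpret T: three_maps p1 p2 p3 "1/2" 4 "5/4" "9/10" "11/10" "1/4" "27/20"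
      by (intro three_maps_admissible p(4-6) \<epsilon>(2-4))
    show ?thesis using T.G_properties unfolding p(1-3) Let_def .
  qed
  ultimately show ?thesis by (intro exI[of _ V]) auto
qed

end
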